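(* Let $N\ge1$ and $M\ge0$ be integers and let $\lambda,\mu$ be partitions with $\lambda_k\ge\mu_k$ for all $k\ge 1$, $\lambda'_1+\lambda'_2\le N+M$ and $\mu'_1+\mu'_2\le M$. Let $\omega$ be the corresponding skew Young diagram with $n$ boxes, let $\Omega$ be its column tableau, with contents $c_1,\dots,c_n$. Consider the product $$\prod_{1\le k<l\le n}^{\longrightarrow}\Bigl(1-\frac{Q_{kl}}{c_k+c_l+t_k+t_l+N+M}\Bigr)\cdot\prod_{1\le k<l\le n}^{\longrightarrow}\Bigl(1-\frac{P_{kl}}{c_k-c_l+t_k-t_l}\Bigr)$$ as a rational function, with values in operators on $(\mathbb C^N)^{\otimes n}$, of the complex variables $t_1,\dots,t_n$ constrained by $t_k=t_l$ whenever $k$ and $l$ occur in the same column of $\Omega$. At $t_1=\dots=t_n=-\frac12$ this function has the value $$\prod_{(k,l)}^{\longrightarrow}\Bigl(1-\frac{Q_{kl}}{c_k+c_l+N+M-1}\Bigr)\cdot E_\Omega\;=\;E_\Omega\cdot\prod_{(k,l)}^{\longleftarrow}\Bigl(1-\frac{Q_{kl}}{c_k+c_l+N+M-1}\Bigr),$$ where the ordered products in the last display are taken over all pairs $(k,l)$, $1\le k<l\le n$, such that the numbers $k$ and $l$ appear in different columns of the tableau $\Omega$.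
   Context: For a partition $\nu$, $\nu'$ denotes the conjugate partition. The skew Young diagram is $\omega=\{(i,j)\in\mathbb Z^2: i\ge1,\ \lambda_i\ge j>\mu_i\}$, where $i$ is the row index (increasing downwards) and $j$ the column index (increasing to the right); $n=|\omega|$. The column tableau $\Omega$ is obtained by filling the boxes of $\omega$ with $1,\dots,n$ consecutively by columns from left to right, downwards in every column. The content $c_k$ is $j-i$ if the box $(i,j)$ contains $k$. On $(\mathbb C^N)^{\otimes n}$, $P_{kl}$ exchanges the $k$th and $l$th tensor factors. $Q_{kl}$ acts as $u\otimes v\mapsto\langle u,v\rangle\sum_{i=1}^N e_i\otimes e_i$ in the $k$th and $l$th tensor factors and as the identity in the remaining $n-2$ factors, where $e_1,\dots,e_N$ is the standard basis of $\mathbb C^N$ and $\langle\ ,\ \rangle$ is the symmetric bilinear form with $\langle e_i,e_j\rangle=\delta_{ij}$. $\prod^{\longrightarrow}$ denotes the product in which the factors are written from left to right in the lexicographic order of the pairs $(k,l)$; $\prod^{\longleftarrow}$ denotes the product of the factors in the reversed order. The rational function $\prod^{\longrightarrow}_{1\le k<l\le n}\bigl(1-\frac{P_{kl}}{c_k-c_l+t_k-t_l}\bigr)$ of the constrained variables is regular at $t_1=\dots=t_n$ and depends only on the differences $t_k-t_l$; $E_\Omega$ denotes its value at $t_1=\dots=t_n$. All the denominators $c_k+c_l+N+M-1$ with $k,l$ in different columns of $\Omega$ are non-zero under the stated assumptions. *)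

theory Defs
  imports Complex_Main "HOL-Library.FuncSet" "HOL-Combinatorics.Transposition"
begin

section \<open>Skew Young diagrams and their column tableaux\<close>

text \<open>Partitions are 1-indexed; the value at index 0 is irrelevant.\<close>

definition is_partition :: "(nat \<Rightarrow> nat) \<Rightarrow> bool" where
  "is_partition lam \<longleftrightarrow> (\<forall>i\<ge>1. lam (Suc i) \<le> lam i) \<and> finite {i. 1 \<le> i \<and> lam i \<noteq> 0}"

definition conjugate :: "(nat \<Rightarrow> nat) \<Rightarrow> nat \<Rightarrow> nat" where
  "conjugate lam j = card {i. 1 \<le> i \<and> j \<le> lam i}"

definition skew_diagram :: "(nat \<Rightarrow> nat) \<Rightarrow> (nat \<Rightarrow> nat) \<Rightarrow> (nat \<times> nat) set" where
  "skew_diagram lam mu = {(i, j). 1 \<le> i \<and> mu i < j \<and> j \<le> lam i}"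

text \<open>A box receives as its entry the number of boxes not after it in the order by columns
  from left to right, downwards in every column.\<close>

definition column_tableau :: "(nat \<times> nat) set \<Rightarrow> nat \<times> nat \<Rightarrow> nat" where
  "column_tableau \<omega> = (\<lambda>(i, j). card {(i', j') \<in> \<omega>. j' < j \<or> (j' = j \<and> i' \<le> i)})"

definition box_of :: "(nat \<times> nat) set \<Rightarrow> nat \<Rightarrow> nat \<times> nat" where
  "box_of \<omega> k = the_inv_into \<omega> (column_tableau \<omega>) k"

definition content :: "(nat \<times> nat) set \<Rightarrow> nat \<Rightarrow> int" where
  "content \<omega> k = int (snd (box_of \<omega> k)) - int (fst (box_of \<omega> k))"

definition same_column :: "(nat \<times> nat) set \<Rightarrow> nat \<Rightarrow> nat \<Rightarrow> bool" where
  "same_column \<omega> k l \<longleftrightarrow> snd (box_of \<omega> k) = snd (box_of \<omega> l)"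


section \<open>Operators on tensor powers\<close>

text \<open>A tensor in the \<open>n\<close>-th tensor power of \<open>\<complex>\<^sup>N\<close> is given by its coordinates in the basis
  \<open>e\<^bsub>a 1\<^esub> \<otimes> \<dots> \<otimes> e\<^bsub>a n\<^esub>\<close>, extended by 0 to functions \<open>a\<close> that are not multi-indices.\<close>

type_synonym tensor = "(nat \<Rightarrow> nat) \<Rightarrow> complex"

definition multi_indices :: "nat \<Rightarrow> nat \<Rightarrow> (nat \<Rightarrow> nat) set" where
  "multi_indices n N = {1..n} \<rightarrow>\<^sub>E {1..N}"

definition tensors :: "nat \<Rightarrow> nat \<Rightarrow> tensor set" where
  "tensors n N = {x. \<forall>a. a \<notin> multi_indices n N \<longrightarrow> x a = 0}"

definition P_op :: "nat \<Rightarrow> nat \<Rightarrow> tensor \<Rightarrow> tensor" where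
  "P_op k l x = (\<lambda>a. x (a \<circ> transpose k l))"

definition Q_op :: "nat \<Rightarrow> nat \<Rightarrow> nat \<Rightarrow> nat \<Rightarrow> tensor \<Rightarrow> tensor" where
  "Q_op n N k l x =
     (\<lambda>a. if a \<in> multi_indices n N \<and> a k = a l then \<Sum>i = 1..N. x (a(k := i, l := i)) else 0)"

text \<open>The action of these operators on decomposable tensors \<open>w 1 \<otimes> \<dots> \<otimes> w n\<close>, where
  \<open>w r i\<close> is the \<open>i\<close>-th coordinate of the vector \<open>w r\<close>.\<close>

definition pure_tensor :: "nat \<Rightarrow> nat \<Rightarrow> (nat \<Rightarrow> nat \<Rightarrow> complex) \<Rightarrow> tensor" where
  "pure_tensor n N w = (\<lambda>a. if a \<in> multi_indices n N then \<Prod>r = 1..n. w r (a r) else 0)"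

definition std_vec :: "nat \<Rightarrow> nat \<Rightarrow> complex" where
  "std_vec i = (\<lambda>j. if j = i then 1 else 0)"

lemma multi_indices_transpose_iff:
  assumes "k \<in> {1..n}" "l \<in> {1..n}"
  shows "a \<circ> transpose k l \<in> multi_indices n N \<longleftrightarrow> a \<in> multi_indices n N"
proof -
  have *: "b \<circ> transpose k l \<in> multi_indices n N" if "b \<in> multi_indices n N" for b
    using that assms
    by (auto simp: multi_indices_def PiE_iff extensional_def transpose_def)
  show ?thesis
    using *[of a] *[of "a \<circ> transpose k l"] by (auto simp: comp_assoc)
qed

lemma P_op_pure_tensor:
  assumes "k \<in> {1..n}" "l \<in> {1..n}"
  shows "P_op k l (pure_tensor n N w) = pure_tensor n N (w \<circ> transpose k l)"
proof
  fix a
  have bij: "bij_betw (transpose k l) {1..n} {1..n}"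
    using assms by (intro bij_betw_byWitness[where f' = "transpose k l"])
      (auto simp: transpose_def)
  have "(\<Prod>r = 1..n. w r (a (transpose k l r))) = (\<Prod>r = 1..n. w (transpose k l r) (a r))"
    using prod.reindex_bij_betw[OF bij, of "\<lambda>r. w r (a (transpose k l r))"] by simp
  then show "P_op k l (pure_tensor n N w) a = pure_tensor n N (w \<circ> transpose k l) a"
    using multi_indices_transpose_iff[OF assms, of a N] by (simp add: P_op_def pure_tensor_def)
qed

lemma Q_op_pure_tensor:
  assumes kl: "k \<in> {1..n}" "l \<in> {1..n}" "k \<noteq> l"
  shows "Q_op n N k l (pure_tensor n N w) a =
    (\<Sum>i = 1..N. w k i * w l i) *
    (\<Sum>i = 1..N. pure_tensor n N (w(k := std_vec i, l := std_vec i)) a)"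
proof (cases "a \<in> multi_indices n N")
  case False
  then show ?thesis by (simp add: Q_op_def pure_tensor_def)
next
  case True
  let ?R = "{1..n} - {k} - {l}"
  let ?p = "\<Prod>r \<in> ?R. w r (a r)"
  have split: "(\<Prod>r = 1..n. f r) = f k * (f l * prod f ?R)" for f :: "nat \<Rightarrow> complex"
    using kl prod.remove[of "{1..n}" k f] prod.remove[of "{1..n} - {k}" l f] by simp
  have upd: "pure_tensor n N w (a(k := i, l := i)) = w k i * w l i * ?p" if "i \<in> {1..N}" for i
  proof -
    have "a(k := i, l := i) \<in> multi_indices n N"
      using True that kl by (auto simp: multi_indices_def PiE_iff extensional_def)
    moreover have "(\<Prod>r \<in> ?R. w r ((a(k := i, l := i)) r)) = ?p"
      by (intro prod.cong) auto
    ultimately show ?thesis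
      using kl split[of "\<lambda>r. w r ((a(k := i, l := i)) r)"] by (simp add: pure_tensor_def)
  qed
  have std: "pure_tensor n N (w(k := std_vec i, l := std_vec i)) a =
      (if a k = i \<and> a l = i then ?p else 0)" for i
  proof -
    have "(\<Prod>r \<in> ?R. (w(k := std_vec i, l := std_vec i)) r (a r)) = ?p"
      by (intro prod.cong) auto
    then show ?thesis
      using True kl split[of "\<lambda>r. (w(k := std_vec i, l := std_vec i)) r (a r)"]
      by (simp add: pure_tensor_def std_vec_def)
  qed
  have ak: "a k \<in> {1..N}"
    using True kl by (auto simp: multi_indices_def)
  have "(\<Sum>i = 1..N. pure_tensor n N (w(k := std_vec i, l := std_vec i)) a) =
      (\<Sum>i = 1..N. if a k = i then (if a k = a l then ?p else 0) else 0)"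
    unfolding std by (intro sum.cong) auto
  also have "\<dots> = (if a k = a l then ?p else 0)"
    using ak by (subst sum.delta') auto
  finally show ?thesis
    using True upd by (simp add: Q_op_def sum_distrib_right)
qed

definition one_minus_over :: "(tensor \<Rightarrow> tensor) \<Rightarrow> complex \<Rightarrow> tensor \<Rightarrow> tensor" where
  "one_minus_over A d x = (\<lambda>a. x a - A x a / d)"

definition lex_pairs :: "nat \<Rightarrow> (nat \<times> nat) list" where
  "lex_pairs n = [(k, l). k \<leftarrow> [1..<Suc n], l \<leftarrow> [Suc k..<Suc n]]"

definition ordered_prod ::
    "(nat \<Rightarrow> nat \<Rightarrow> tensor \<Rightarrow> tensor) \<Rightarrow> (nat \<times> nat) list \<Rightarrow> tensor \<Rightarrow> tensor" where
  "ordered_prod F ps = foldr (\<lambda>(k, l) A. F k l \<circ> A) ps id"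


section \<open>Values of rational functions\<close>

inductive polynomial_fun :: "nat \<Rightarrow> ((nat \<Rightarrow> complex) \<Rightarrow> complex) \<Rightarrow> bool" for n :: nat where
  const: "polynomial_fun n (\<lambda>t. c)"
| var: "k \<in> {1..n} \<Longrightarrow> polynomial_fun n (\<lambda>t. t k)"
| add: "polynomial_fun n p \<Longrightarrow> polynomial_fun n q \<Longrightarrow> polynomial_fun n (\<lambda>t. p t + q t)"
| mult: "polynomial_fun n p \<Longrightarrow> polynomial_fun n q \<Longrightarrow> polynomial_fun n (\<lambda>t. p t * q t)"

text \<open>Here \<open>f\<close> is a rational function of variables ranging over a linear subspace containing
  \<open>t0\<close>, and \<open>D\<close> is the part of that subspace where no denominator in the given expression for
  \<open>f\<close> vanishes. The function is regular at \<open>t0\<close> (which need not lie in \<open>D\<close>) if it can be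
  written with a denominator not vanishing at \<open>t0\<close>.\<close>

definition has_regular_value ::
    "nat \<Rightarrow> (nat \<Rightarrow> complex) set \<Rightarrow> ((nat \<Rightarrow> complex) \<Rightarrow> complex) \<Rightarrow> (nat \<Rightarrow> complex) \<Rightarrow> complex \<Rightarrow> bool"
  where
  "has_regular_value n D f t0 v \<longleftrightarrow>
     (\<exists>p q. polynomial_fun n p \<and> polynomial_fun n q \<and> q t0 \<noteq> 0 \<and>
        (\<forall>t\<in>D. q t * f t = p t) \<and> v = p t0 / q t0)"

definition has_operator_value ::
    "nat \<Rightarrow> nat \<Rightarrow> (nat \<Rightarrow> complex) set \<Rightarrow> ((nat \<Rightarrow> complex) \<Rightarrow> tensor \<Rightarrow> tensor) \<Rightarrow>
     (nat \<Rightarrow> complex) \<Rightarrow> (tensor \<Rightarrow> tensor) \<Rightarrow> bool"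
  where
  "has_operator_value n N D F t0 A \<longleftrightarrow>
     (\<forall>x\<in>tensors n N. A x \<in> tensors n N \<and>
        (\<forall>a\<in>multi_indices n N. has_regular_value n D (\<lambda>t. F t x a) t0 (A x a)))"


section \<open>The products associated with a skew diagram\<close>

definition constrained :: "(nat \<times> nat) set \<Rightarrow> (nat \<Rightarrow> complex) set" where
  "constrained \<omega> =
     {t. \<forall>k\<in>{1..card \<omega>}. \<forall>l\<in>{1..card \<omega>}. same_column \<omega> k l \<longrightarrow> t k = t l}"

definition P_denom :: "(nat \<times> nat) set \<Rightarrow> (nat \<Rightarrow> complex) \<Rightarrow> nat \<Rightarrow> nat \<Rightarrow> complex" where
  "P_denom \<omega> t k l = of_int (content \<omega> k) - of_int (content \<omega> l) + t k - t l"

definition Q_denom ::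
    "nat \<Rightarrow> nat \<Rightarrow> (nat \<times> nat) set \<Rightarrow> (nat \<Rightarrow> complex) \<Rightarrow> nat \<Rightarrow> nat \<Rightarrow> complex" where
  "Q_denom N M \<omega> t k l =
     of_int (content \<omega> k) + of_int (content \<omega> l) + t k + t l + of_nat N + of_nat M"

definition P_domain :: "(nat \<times> nat) set \<Rightarrow> (nat \<Rightarrow> complex) set" where
  "P_domain \<omega> =
     {t \<in> constrained \<omega>. \<forall>(k, l) \<in> set (lex_pairs (card \<omega>)). P_denom \<omega> t k l \<noteq> 0}"

definition Q_domain :: "nat \<Rightarrow> nat \<Rightarrow> (nat \<times> nat) set \<Rightarrow> (nat \<Rightarrow> complex) set" where
  "Q_domain N M \<omega> =
     {t \<in> constrained \<omega>. \<forall>(k, l) \<in> set (lex_pairs (card \<omega>)). Q_denom N M \<omega> t k l \<noteq> 0}"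

definition P_prod :: "(nat \<times> nat) set \<Rightarrow> (nat \<Rightarrow> complex) \<Rightarrow> tensor \<Rightarrow> tensor" where
  "P_prod \<omega> t =
     ordered_prod (\<lambda>k l. one_minus_over (P_op k l) (P_denom \<omega> t k l)) (lex_pairs (card \<omega>))"

definition Q_prod ::
    "nat \<Rightarrow> nat \<Rightarrow> (nat \<times> nat) set \<Rightarrow> (nat \<Rightarrow> complex) \<Rightarrow> tensor \<Rightarrow> tensor" where
  "Q_prod N M \<omega> t =
     ordered_prod (\<lambda>k l. one_minus_over (Q_op (card \<omega>) N k l) (Q_denom N M \<omega> t k l))
       (lex_pairs (card \<omega>))"

text \<open>The operator is made extensional so that the description is unique; its value is the
  same at all points with \<open>t\<^sub>1 = \<dots> = t\<^sub>n\<close>.\<close>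

definition E_op :: "nat \<Rightarrow> (nat \<times> nat) set \<Rightarrow> tensor \<Rightarrow> tensor" where
  "E_op N \<omega> =
     (THE A. A \<in> tensors (card \<omega>) N \<rightarrow>\<^sub>E tensors (card \<omega>) N \<and>
        (\<forall>z. has_operator_value (card \<omega>) N (P_domain \<omega>) (P_prod \<omega>) (\<lambda>_. z) A))"

definition different_column_pairs :: "(nat \<times> nat) set \<Rightarrow> (nat \<times> nat) list" where
  "different_column_pairs \<omega> =
     filter (\<lambda>(k, l). \<not> same_column \<omega> k l) (lex_pairs (card \<omega>))"

definition Q_factor :: "nat \<Rightarrow> nat \<Rightarrow> (nat \<times> nat) set \<Rightarrow> nat \<Rightarrow> nat \<Rightarrow> tensor \<Rightarrow> tensor" where
  "Q_factor N M \<omega> k l =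
     one_minus_over (Q_op (card \<omega>) N k l)
       (of_int (content \<omega> k + content \<omega> l + int N + int M - 1))"

end

theory Submission
  imports Defs
begin

text \<open>Write \<open>x\<^sub>k = c\<^sub>k + t\<^sub>k\<close>. The theorem rests on three facts about the factors
\<open>1 - P\<^sub>k\<^sub>l / (x\<^sub>k - x\<^sub>l)\<close> and \<open>1 - Q\<^sub>k\<^sub>l / (x\<^sub>k + x\<^sub>l + N + M)\<close>.

Poles of the \<open>P\<close>-product. The entries of a column \<open>C\<close> have contents decreasing by one, so the factors
inside \<open>C\<close> multiply to an antisymmetrizer \<open>A\<^sub>C\<close>. For \<open>k\<close> outside \<open>C\<close>, the product of the factors
\<open>(k, l)\<close>, \<open>l \<in> C\<close>, collapses in front of \<open>A\<^sub>C\<close> to \<open>1 - (\<Sum>l\<in>C. P\<^sub>k\<^sub>l) / (x\<^sub>k - x\<^sub>b)\<close>, where \<open>b\<close> is the top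
entry of \<open>C\<close> (\<open>column_pole_cancellation\<close>): of all the poles only the one at the top box survives. In a
skew diagram the diagonal through the top box of a column meets no earlier column
(\<open>content_ne_top_of_later_column\<close>). Collecting the antisymmetrizers on the left therefore writes the
\<open>P\<close>-product as an antisymmetrizer times a product that is visibly regular at \<open>t\<^sub>1 = \<dots> = t\<^sub>n\<close>
(\<open>fusion_factorization\<close>), and this expression is \<open>E\<^sub>\<Omega>\<close>.

Removing the factors inside columns. By the Yang--Baxter equation for one \<open>P\<close>- and two \<open>Q\<close>-factors, a row
of \<open>Q\<close>-factors slides through \<open>A\<^sub>C\<close> with its order reversed. This brings \<open>A\<^sub>C\<close> next to the
\<open>Q\<close>-factors inside \<open>C\<close>, which it absorbs because \<open>Q\<^sub>k\<^sub>l = Q\<^sub>k\<^sub>l P\<^sub>k\<^sub>l\<close> kills antisymmetric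
tensors. So in front of \<open>E\<^sub>\<Omega>\<close> only factors from different columns matter (\<open>reduced_B_product\<close>), and
their denominators at \<open>t\<^sub>k = -1/2\<close> are positive since \<open>\<lambda>'\<^sub>1 + \<lambda>'\<^sub>2 \<le> N + M\<close>
(\<open>content_sum_bound\<close>).

The second expression for the value. At generic \<open>t\<close> the Yang--Baxter equations give that the \<open>P\<close>-product
equals its own reversal and that passing it through the \<open>Q\<close>-product reverses the latter
(\<open>fusion_eq_rev_fusion\<close>, \<open>B_fusion_exchange\<close>). All \<open>P\<^sub>k\<^sub>l\<close> and \<open>Q\<^sub>k\<^sub>l\<close> are self-adjoint, so taking
adjoints in the previous step removes the factors inside columns from the reversed product on the right of
\<open>E\<^sub>\<Omega>\<close> as well (\<open>Z_E_lin_exchange\<close>). This generic identity passes to \<open>t\<^sub>k = -1/2\<close> because a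
regular value is determined by the values near the point on the constrained subspace
(\<open>has_regular_value_unique\<close>).\<close>

section \<open>Noncommutative products over pairs\<close>

text \<open>The lexicographic product over the pairs of a list and its reversal. Recursion on the list splits off the
pairs with a fixed first entry, a row, which is the form in which all exchange arguments below proceed.\<close>

primrec pair_prod :: "('i \<Rightarrow> 'i \<Rightarrow> 'a) \<Rightarrow> 'i list \<Rightarrow> 'a::monoid_mult" where
  "pair_prod F [] = 1"
| "pair_prod F (x # xs) = (\<Prod>y\<leftarrow>xs. F x y) * pair_prod F xs"

primrec rev_pair_prod :: "('i \<Rightarrow> 'i \<Rightarrow> 'a) \<Rightarrow> 'i list \<Rightarrow> 'a::monoid_mult" where
  "rev_pair_prod F [] = 1"
| "rev_pair_prod F (x # xs) = rev_pair_prod F xs * (\<Prod>y\<leftarrow>rev xs. F x y)"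

lemma pair_prod_cong:
  assumes "\<And>k l. k \<in> set xs \<Longrightarrow> l \<in> set xs \<Longrightarrow> F k l = G k l"
  shows "pair_prod F xs = pair_prod G xs"
  using assms by (induction xs) (auto intro!: arg_cong2[of _ _ _ _ "(*)"] arg_cong[of _ _ prod_list])

lemma prod_list_commute:
  fixes a :: "'a::monoid_mult"
  assumes "\<And>y. y \<in> set ys \<Longrightarrow> a * f y = f y * a"
  shows "a * (\<Prod>y\<leftarrow>ys. f y) = (\<Prod>y\<leftarrow>ys. f y) * a"
  using assms
proof (induction ys)
  case (Cons y ys)
  have "a * (\<Prod>y\<leftarrow>y # ys. f y) = (a * f y) * (\<Prod>y\<leftarrow>ys. f y)"
    by (simp add: mult.assoc)
  also have "\<dots> = f y * (a * (\<Prod>y\<leftarrow>ys. f y))"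
    using Cons.prems by (simp add: mult.assoc)
  also have "\<dots> = (\<Prod>y\<leftarrow>y # ys. f y) * a"
    using Cons by (simp add: mult.assoc)
  finally show ?case .
qed simp

lemma pair_prod_commute:
  fixes a :: "'a::monoid_mult"
  assumes "distinct xs"
    and "\<And>k l. k \<in> set xs \<Longrightarrow> l \<in> set xs \<Longrightarrow> k \<noteq> l \<Longrightarrow> a * F k l = F k l * a"
  shows "a * pair_prod F xs = pair_prod F xs * a"
  using assms
proof (induction xs)
  case (Cons x xs)
  have "a * (\<Prod>y\<leftarrow>xs. F x y) = (\<Prod>y\<leftarrow>xs. F x y) * a"
    using Cons.prems by (intro prod_list_commute) auto
  then have "a * pair_prod F (x # xs) = (\<Prod>y\<leftarrow>xs. F x y) * (a * pair_prod F xs)"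
    by (simp add: mult.assoc[symmetric])
  also have "a * pair_prod F xs = pair_prod F xs * a"
    using Cons by simp
  finally show ?case by (simp add: mult.assoc)
qed simp

lemma rev_pair_prod_commute:
  fixes a :: "'a::monoid_mult"
  assumes "distinct xs"
    and "\<And>k l. k \<in> set xs \<Longrightarrow> l \<in> set xs \<Longrightarrow> k \<noteq> l \<Longrightarrow> a * F k l = F k l * a"
  shows "a * rev_pair_prod F xs = rev_pair_prod F xs * a"
  using assms
proof (induction xs)
  case (Cons x xs)
  have *: "a * (\<Prod>y\<leftarrow>rev xs. F x y) = (\<Prod>y\<leftarrow>rev xs. F x y) * a"
    using Cons.prems by (intro prod_list_commute) auto
  have "a * rev_pair_prod F (x # xs) = (a * rev_pair_prod F xs) * (\<Prod>y\<leftarrow>rev xs. F x y)"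
    by (simp add: mult.assoc)
  also have "a * rev_pair_prod F xs = rev_pair_prod F xs * a"
    using Cons by simp
  finally show ?case using * by (simp add: mult.assoc)
qed simp

text \<open>Splitting a lexicographic product into the pairs within each part and the rectangular block between the
parts only moves factors with four distinct indices past each other.\<close>

lemma pair_prod_append:
  fixes F :: "'i \<Rightarrow> 'i \<Rightarrow> 'a::monoid_mult"
  assumes "distinct (xs @ ys)"
    and "\<And>i j k l. distinct [i, j, k, l] \<Longrightarrow> {i, j, k, l} \<subseteq> set (xs @ ys) \<Longrightarrow> F i j * F k l = F k l * F i j"
  shows "pair_prod F (xs @ ys) = pair_prod F xs * (\<Prod>x\<leftarrow>xs. \<Prod>y\<leftarrow>ys. F x y) * pair_prod F ys"
  using assms
proof (induction xs)
  case (Cons x xs)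
  have "(\<Prod>y\<leftarrow>ys. F x y) * F k l = F k l * (\<Prod>y\<leftarrow>ys. F x y)"
    if "k \<in> set xs" "l \<in> set xs" "k \<noteq> l" for k l
    using Cons.prems(1) that by (intro prod_list_commute[symmetric] Cons.prems(2)) auto
  then have c: "(\<Prod>y\<leftarrow>ys. F x y) * pair_prod F xs = pair_prod F xs * (\<Prod>y\<leftarrow>ys. F x y)"
    using Cons.prems by (intro pair_prod_commute) auto
  have "pair_prod F ((x # xs) @ ys) = (\<Prod>y\<leftarrow>xs. F x y) * (\<Prod>y\<leftarrow>ys. F x y) * pair_prod F (xs @ ys)"
    by simp
  also have "pair_prod F (xs @ ys) = pair_prod F xs * (\<Prod>x\<leftarrow>xs. \<Prod>y\<leftarrow>ys. F x y) * pair_prod F ys"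
    using Cons.prems(1) by (intro Cons.IH Cons.prems(2)) auto
  also have "(\<Prod>y\<leftarrow>xs. F x y) * (\<Prod>y\<leftarrow>ys. F x y) * \<dots> = (\<Prod>y\<leftarrow>xs. F x y) * ((\<Prod>y\<leftarrow>ys. F x y) *
      pair_prod F xs) * (\<Prod>x\<leftarrow>xs. \<Prod>y\<leftarrow>ys. F x y) * pair_prod F ys"
    by (simp add: mult.assoc)
  finally show ?case
    unfolding c by (simp add: mult.assoc)
qed simp

text \<open>In a rectangular block the order by rows and the order by columns differ only by exchanges of factors with
no common index.\<close>

lemma prod_list_swap:
  fixes F :: "'i \<Rightarrow> 'j \<Rightarrow> 'a::monoid_mult"
  assumes "distinct xs" "distinct ys"
    and "\<And>i j k l. i \<in> set xs \<Longrightarrow> k \<in> set xs \<Longrightarrow> j \<in> set ys \<Longrightarrow> l \<in> set ys \<Longrightarrow> i \<noteq> k \<Longrightarrow> j \<noteq> l \<Longrightarrow>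
      F i j * F k l = F k l * F i j"
  shows "(\<Prod>x\<leftarrow>xs. \<Prod>y\<leftarrow>ys. F x y) = (\<Prod>y\<leftarrow>ys. \<Prod>x\<leftarrow>xs. F x y)"
  using assms
proof (induction ys)
  case (Cons y ys)
  have "(\<Prod>x\<leftarrow>xs. F x y * G x) = (\<Prod>x\<leftarrow>xs. F x y) * (\<Prod>x\<leftarrow>xs. G x)"
    if "G = (\<lambda>x. \<Prod>y\<leftarrow>ys. F x y)" for G
    using Cons.prems(1,3)
  proof (induction xs)
    case (Cons x xs)
    have "G x * (\<Prod>x\<leftarrow>xs. F x y) = (\<Prod>x\<leftarrow>xs. F x y) * G x"
      unfolding that using Cons.prems(1) \<open>distinct (y # ys)\<close>
      by (intro prod_list_commute prod_list_commute[symmetric] Cons.prems(2)) auto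
    then show ?case
      using Cons by (simp add: mult.assoc) (simp add: mult.assoc[symmetric])
  qed simp
  then show ?case
    using Cons by simp
qed (simp add: map_replicate_const)

text \<open>The relation \<open>a f\<^sub>y r\<^sub>y = r\<^sub>y f\<^sub>y a\<close> propagates along a row: once \<open>a\<close> has passed the first pair
\<open>f\<^sub>y, r\<^sub>y\<close>, it stands next to the second one.\<close>

lemma slide_past_row:
  fixes f :: "'i \<Rightarrow> 'a::monoid_mult"
  assumes "distinct ys"
    and "\<And>y. y \<in> set ys \<Longrightarrow> a * f y * r y = r y * f y * a"
    and "\<And>y z. y \<in> set ys \<Longrightarrow> z \<in> set ys \<Longrightarrow> y \<noteq> z \<Longrightarrow> f y * r z = r z * f y"
  shows "a * (\<Prod>y\<leftarrow>ys. f y) * (\<Prod>y\<leftarrow>ys. r y) = (\<Prod>y\<leftarrow>ys. r y) * (\<Prod>y\<leftarrow>ys. f y) * a"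
  using assms
proof (induction ys)
  case (Cons y ys)
  let ?F = "\<Prod>y\<leftarrow>ys. f y" and ?R = "\<Prod>y\<leftarrow>ys. r y"
  have 1: "?F * r y = r y * ?F"
    using Cons.prems(1) by (intro prod_list_commute[symmetric] Cons.prems(3)[symmetric]) auto
  have 2: "f y * ?R = ?R * f y"
    using Cons.prems(1) by (intro prod_list_commute Cons.prems(3)) auto
  have "a * (f y * ?F) * (r y * ?R) = a * f y * (?F * r y) * ?R"
    by (simp add: mult.assoc)
  also have "\<dots> = (a * f y * r y) * (?F * ?R)"
    unfolding 1 by (simp add: mult.assoc)
  also have "\<dots> = r y * f y * (a * ?F * ?R)"
    using Cons.prems by (simp add: mult.assoc)
  also have "a * ?F * ?R = ?R * ?F * a"
    using Cons by simp
  also have "r y * f y * (?R * ?F * a) = r y * (f y * ?R) * ?F * a"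
    by (simp add: mult.assoc)
  finally show ?case
    unfolding 2 by (simp add: mult.assoc)
qed simp

text \<open>This is how the Yang--Baxter equation \<open>f\<^sub>k f\<^sub>l R\<^sub>k\<^sub>l = R\<^sub>k\<^sub>l f\<^sub>l f\<^sub>k\<close> is used. With \<open>R\<^sub>k\<^sub>l\<close> playing the part of the
transposition of neighbours \<open>k, l\<close>, the lexicographic product of all \<open>R\<^sub>k\<^sub>l\<close> corresponds to the longest
permutation, so it reverses the order of the \<open>f\<^sub>k\<close>.\<close>

lemma slide:
  fixes f :: "'i \<Rightarrow> 'a::monoid_mult"
  assumes "distinct xs"
    and "\<And>k l. k \<in> set xs \<Longrightarrow> l \<in> set xs \<Longrightarrow> k \<noteq> l \<Longrightarrow> f k * f l * R k l = R k l * f l * f k"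
    and "\<And>j k l. distinct [j, k, l] \<Longrightarrow> {j, k, l} \<subseteq> set xs \<Longrightarrow> f j * R k l = R k l * f j"
  shows "(\<Prod>x\<leftarrow>xs. f x) * pair_prod R xs = pair_prod R xs * (\<Prod>x\<leftarrow>rev xs. f x)"
  using assms
proof (induction xs)
  case (Cons x xs)
  let ?F = "\<Prod>y\<leftarrow>xs. f y" and ?R = "\<Prod>y\<leftarrow>xs. R x y"
  have 1: "f x * ?F * ?R = ?R * ?F * f x"
    using Cons.prems(1) by (intro slide_past_row Cons.prems(2,3)) auto
  have 2: "f x * pair_prod R xs = pair_prod R xs * f x"
    using Cons.prems(1) by (intro pair_prod_commute Cons.prems(3)) auto
  have "(\<Prod>x\<leftarrow>x # xs. f x) * pair_prod R (x # xs) = (f x * ?F * ?R) * pair_prod R xs"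
    by (simp add: mult.assoc)
  also have "\<dots> = ?R * (?F * pair_prod R xs) * f x"
    unfolding 1 by (simp add: mult.assoc 2)
  also have "?F * pair_prod R xs = pair_prod R xs * (\<Prod>x\<leftarrow>rev xs. f x)"
    using Cons by simp
  finally show ?case
    by (simp add: mult.assoc)
qed simp

text \<open>Induction on the list: each new row is a family \<open>f\<close> to which the sliding lemma applies.\<close>

lemma pair_prod_eq_rev_pair_prod:
  fixes R :: "'i \<Rightarrow> 'i \<Rightarrow> 'a::monoid_mult"
  assumes "distinct xs"
    and "\<And>j k l. distinct [j, k, l] \<Longrightarrow> {j, k, l} \<subseteq> set xs \<Longrightarrow>
      R j k * R j l * R k l = R k l * R j l * R j k"
    and "\<And>i j k l. distinct [i, j, k, l] \<Longrightarrow> {i, j, k, l} \<subseteq> set xs \<Longrightarrow>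
      R i j * R k l = R k l * R i j"
  shows "pair_prod R xs = rev_pair_prod R xs"
  using assms
proof (induction xs)
  case (Cons x xs)
  have "(\<Prod>y\<leftarrow>xs. R x y) * pair_prod R xs = pair_prod R xs * (\<Prod>y\<leftarrow>rev xs. R x y)"
    using Cons.prems(1) by (intro slide Cons.prems(2,3)) auto
  moreover have "pair_prod R xs = rev_pair_prod R xs"
    using Cons.prems(1) by (intro Cons.IH Cons.prems(2,3)) auto
  ultimately show ?case
    by simp
qed simp

text \<open>In the application, \<open>m\<^sub>k\<close> and \<open>r\<^sub>k\<close> are the factors \<open>Q\<^sub>j\<^sub>k\<close> and \<open>R\<^sub>j\<^sub>k\<close> for one further index \<open>j\<close>, and
\<open>m\<^sub>k Q\<^sub>k\<^sub>l r\<^sub>l = r\<^sub>l Q\<^sub>k\<^sub>l m\<^sub>k\<close> is the Yang--Baxter equation in which \<open>k\<close> is the index common to the two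
\<open>Q\<close>-factors. The lemma is the step that adds the index \<open>j\<close> in the exchange of the two full products.\<close>

lemma exchange_rows:
  fixes Q :: "'i \<Rightarrow> 'i \<Rightarrow> 'a::monoid_mult"
  assumes "distinct xs"
    and "\<And>k. k \<in> set xs \<Longrightarrow> m k * r k = r k * m k"
    and "\<And>k l. k \<in> set xs \<Longrightarrow> l \<in> set xs \<Longrightarrow> k \<noteq> l \<Longrightarrow> Q k l = Q l k"
    and "\<And>k l. k \<in> set xs \<Longrightarrow> l \<in> set xs \<Longrightarrow> k \<noteq> l \<Longrightarrow> m k * Q k l * r l = r l * Q k l * m k"
    and "\<And>j k l. distinct [j, k, l] \<Longrightarrow> {j, k, l} \<subseteq> set xs \<Longrightarrow> m j * Q k l = Q k l * m j"
    and "\<And>j k l. distinct [j, k, l] \<Longrightarrow> {j, k, l} \<subseteq> set xs \<Longrightarrow> r j * Q k l = Q k l * r j"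
  shows "(\<Prod>x\<leftarrow>rev xs. m x) * rev_pair_prod Q xs * (\<Prod>x\<leftarrow>rev xs. r x) =
    (\<Prod>x\<leftarrow>rev xs. r x) * rev_pair_prod Q xs * (\<Prod>x\<leftarrow>rev xs. m x)"
  using assms
proof (induction xs)
  case (Cons x xs)
  let ?M = "\<Prod>y\<leftarrow>rev xs. m y" and ?R = "\<Prod>y\<leftarrow>rev xs. r y" and ?K = "\<Prod>y\<leftarrow>rev xs. Q x y"
  let ?Q = "rev_pair_prod Q xs"
  have 1: "m x * ?K * ?R = ?R * ?K * m x"
  proof (intro slide_past_row)
    show "m x * Q x y * r y = r y * Q x y * m x" if "y \<in> set (rev xs)" for y
      using Cons.prems(1) Cons.prems(4)[of x y] that by auto
  next
    show "Q x y * r z = r z * Q x y" if "y \<in> set (rev xs)" "z \<in> set (rev xs)" "y \<noteq> z" for y z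
      using Cons.prems(1) that by (intro Cons.prems(6)[of z x y, symmetric]) auto
  qed (use Cons.prems(1) in auto)
  have 2: "r x * ?K * ?M = ?M * ?K * r x"
  proof (intro slide_past_row)
    show "r x * Q x y * m y = m y * Q x y * r x" if "y \<in> set (rev xs)" for y
      using Cons.prems(1) Cons.prems(3)[of x y] Cons.prems(4)[of y x] that by fastforce
  next
    show "Q x y * m z = m z * Q x y" if "y \<in> set (rev xs)" "z \<in> set (rev xs)" "y \<noteq> z" for y z
      using Cons.prems(1) that by (intro Cons.prems(5)[of z x y, symmetric]) auto
  qed (use Cons.prems(1) in auto)
  have 3: "m x * ?Q = ?Q * m x" "r x * ?Q = ?Q * r x"
    using Cons.prems(1) by (intro rev_pair_prod_commute Cons.prems(5,6); auto)+
  have 4: "?M * ?Q * ?R = ?R * ?Q * ?M"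
    using Cons.prems(1) by (intro Cons.IH Cons.prems(2-6)) auto
  have 5: "m x * r x = r x * m x"
    using Cons.prems by simp
  have "(\<Prod>x\<leftarrow>rev (x # xs). m x) * rev_pair_prod Q (x # xs) * (\<Prod>x\<leftarrow>rev (x # xs). r x) =
      ?M * (m x * ?Q) * ?K * ?R * r x"
    by (simp add: mult.assoc)
  also have "\<dots> = ?M * ?Q * (m x * ?K * ?R) * r x"
    unfolding 3 by (simp add: mult.assoc)
  also have "\<dots> = (?M * ?Q * ?R) * ?K * (m x * r x)"
    unfolding 1 by (simp add: mult.assoc)
  also have "\<dots> = ?R * ?Q * (?M * ?K * r x) * m x"
    unfolding 4 5 by (simp add: mult.assoc)
  also have "\<dots> = ?R * (?Q * r x) * ?K * ?M * m x"
    unfolding 2[symmetric] by (simp add: mult.assoc)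
  also have "\<dots> = ?R * r x * ?Q * ?K * ?M * m x"
    unfolding 3[symmetric] by (simp add: mult.assoc)
  finally show ?case
    by (simp add: mult.assoc)
qed simp

text \<open>Induction on the list. Sliding turns the leading rows \<open>Q\<^sub>x\<close> and \<open>R\<^sub>x\<close> around, the induction hypothesis
exchanges the remaining products, and the three reversed pieces are reordered by \<open>exchange_rows\<close>.\<close>

lemma pair_prods_exchange:
  fixes Q R :: "'i \<Rightarrow> 'i \<Rightarrow> 'a::monoid_mult"
  assumes "distinct xs"
    and Q_sym: "\<And>k l. k \<in> set xs \<Longrightarrow> l \<in> set xs \<Longrightarrow> k \<noteq> l \<Longrightarrow> Q k l = Q l k"
    and QR: "\<And>k l. k \<in> set xs \<Longrightarrow> l \<in> set xs \<Longrightarrow> k \<noteq> l \<Longrightarrow> Q k l * R k l = R k l * Q k l"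
    and RRR: "\<And>j k l. distinct [j, k, l] \<Longrightarrow> {j, k, l} \<subseteq> set xs \<Longrightarrow>
      R j k * R j l * R k l = R k l * R j l * R j k"
    and QQR: "\<And>j k l. distinct [j, k, l] \<Longrightarrow> {j, k, l} \<subseteq> set xs \<Longrightarrow>
      Q j k * Q j l * R k l = R k l * Q j l * Q j k"
    and comm: "\<And>i j k l. distinct [i, j, k, l] \<Longrightarrow> {i, j, k, l} \<subseteq> set xs \<Longrightarrow>
      R i j * R k l = R k l * R i j"
      "\<And>i j k l. distinct [i, j, k, l] \<Longrightarrow> {i, j, k, l} \<subseteq> set xs \<Longrightarrow>
      Q i j * R k l = R k l * Q i j"
      "\<And>i j k l. distinct [i, j, k, l] \<Longrightarrow> {i, j, k, l} \<subseteq> set xs \<Longrightarrow>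
      Q i j * Q k l = Q k l * Q i j"
  shows "pair_prod Q xs * pair_prod R xs = pair_prod R xs * rev_pair_prod Q xs"
  using assms
proof (induction xs)
  case (Cons x xs)
  note p = Cons.prems
  let ?M = "\<Prod>y\<leftarrow>xs. Q x y" and ?M' = "\<Prod>y\<leftarrow>rev xs. Q x y"
  let ?L = "\<Prod>y\<leftarrow>xs. R x y" and ?L' = "\<Prod>y\<leftarrow>rev xs. R x y"
  let ?Q = "pair_prod Q xs" and ?Q' = "rev_pair_prod Q xs" and ?R = "pair_prod R xs"
  have RL: "?L * ?R = ?R * ?L'"
    using p(1) by (intro slide p(4,6)) auto
  have MR: "?M * ?R = ?R * ?M'"
    using p(1) by (intro slide p(5,7)) auto
  have "?M' * ?Q' * ?L' = ?L' * ?Q' * ?M'"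
  proof (intro exchange_rows)
    show "Q x k * Q k l * R x l = R x l * Q k l * Q x k"
      if "k \<in> set xs" "l \<in> set xs" "k \<noteq> l" for k l
      using p(1) p(5)[of k x l] p(2)[of k x] that by auto
  next
    show "R x j * Q k l = Q k l * R x j" if "distinct [j, k, l]" "{j, k, l} \<subseteq> set xs" for j k l
      using p(1) that by (intro p(7)[of k l x j, symmetric]) auto
  next
    show "Q x j * Q k l = Q k l * Q x j" if "distinct [j, k, l]" "{j, k, l} \<subseteq> set xs" for j k l
      using p(1) p(8)[of x j k l] that by auto
  qed (use p(1) in \<open>auto intro!: p(2,3)\<close>)
  moreover have "?Q * ?R = ?R * ?Q'"
    using p(1) by (intro Cons.IH p(2-8)) auto
  ultimately have "?M * ?Q * (?R * ?L') = ?R * (?L' * ?Q' * ?M')"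
    by (metis MR mult.assoc)
  then show ?case
    using RL by (simp add: mult.assoc)
qed simp

lemma prod_list_intertwine:
  fixes a :: "'a::monoid_mult"
  assumes "\<And>y. y \<in> set ys \<Longrightarrow> f y * a = a * g y"
  shows "(\<Prod>y\<leftarrow>ys. f y) * a = a * (\<Prod>y\<leftarrow>ys. g y)"
  using assms
proof (induction ys)
  case (Cons y ys)
  have IH: "(\<Prod>y\<leftarrow>ys. f y) * a = a * (\<Prod>y\<leftarrow>ys. g y)"
    using Cons by simp
  have "(\<Prod>y\<leftarrow>y # ys. f y) * a = f y * ((\<Prod>y\<leftarrow>ys. f y) * a)"
    by (simp add: mult.assoc)
  also have "\<dots> = (f y * a) * (\<Prod>y\<leftarrow>ys. g y)"
    unfolding IH by (simp add: mult.assoc)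
  also have "\<dots> = a * (\<Prod>y\<leftarrow>y # ys. g y)"
    using Cons.prems[of y] by (simp add: mult.assoc[symmetric])
  finally show ?case .
qed simp

lemma pair_prod_absorb:
  fixes a :: "'a::monoid_mult"
  assumes "distinct xs"
    and "\<And>k l. k \<in> set xs \<Longrightarrow> l \<in> set xs \<Longrightarrow> k \<noteq> l \<Longrightarrow> F k l * a = a"
  shows "pair_prod F xs * a = a"
  using assms
proof (induction xs)
  case (Cons x xs)
  have "(\<Prod>y\<leftarrow>xs. F x y) * a = a * (\<Prod>y\<leftarrow>xs. 1)"
    by (intro prod_list_intertwine) (use Cons.prems in fastforce)
  moreover have "pair_prod F xs * a = a"
    using Cons.prems(1) by (intro Cons.IH Cons.prems(2)) auto
  ultimately show ?case
    by (simp add: mult.assoc map_replicate_const)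
qed simp

section \<open>Brauer relations and the Yang--Baxter equations\<close>

text \<open>The relations of the Brauer algebra between the operators \<open>P\<^sub>k\<^sub>l\<close> and \<open>Q\<^sub>k\<^sub>l\<close> that create no closed
loop. They have the same form for tensor powers of \<open>\<complex>\<^sup>N\<close> for every \<open>N\<close>.\<close>

locale brauer_relations = module scale
  for scale :: "complex \<Rightarrow> 'a::ring_1 \<Rightarrow> 'a" (infixr \<open>*s\<close> 75) +
  fixes P Q :: "'i \<Rightarrow> 'i \<Rightarrow> 'a" and I :: "'i set"
  assumes mult_scale_left [simp]: "(c *s X) * Y = c *s (X * Y)"
    and mult_scale_right [simp]: "X * (c *s Y) = c *s (X * Y)"
    and P_sym: "P k l = P l k"
    and Q_sym: "Q k l = Q l k"
    and P_P: "k \<in> I \<Longrightarrow> l \<in> I \<Longrightarrow> k \<noteq> l \<Longrightarrow> P k l * P k l = 1"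
    and P_conj: "distinct [j, k, l] \<Longrightarrow> {j, k, l} \<subseteq> I \<Longrightarrow> P j k * P j l = P k l * P j k"
    and P_Q_conj: "distinct [j, k, l] \<Longrightarrow> {j, k, l} \<subseteq> I \<Longrightarrow> P j k * Q j l = Q k l * P j k"
    and Q_P: "k \<in> I \<Longrightarrow> l \<in> I \<Longrightarrow> k \<noteq> l \<Longrightarrow> Q k l * P k l = Q k l"
    and P_Q: "k \<in> I \<Longrightarrow> l \<in> I \<Longrightarrow> k \<noteq> l \<Longrightarrow> P k l * Q k l = Q k l"
    and Q_Q: "distinct [j, k, l] \<Longrightarrow> {j, k, l} \<subseteq> I \<Longrightarrow> Q j k * Q j l = Q j k * P k l"
    and P_P_commute: "distinct [i, j, k, l] \<Longrightarrow> {i, j, k, l} \<subseteq> I \<Longrightarrow> P i j * P k l = P k l * P i j"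
    and Q_P_commute: "distinct [i, j, k, l] \<Longrightarrow> {i, j, k, l} \<subseteq> I \<Longrightarrow> Q i j * P k l = P k l * Q i j"
    and Q_Q_commute: "distinct [i, j, k, l] \<Longrightarrow> {i, j, k, l} \<subseteq> I \<Longrightarrow> Q i j * Q k l = Q k l * Q i j"
begin

text \<open>With \<open>y\<^sub>k = c\<^sub>k + t\<^sub>k + (N + M) / 2\<close> the differences \<open>y\<^sub>k - y\<^sub>l\<close> and the sums \<open>y\<^sub>k + y\<^sub>l\<close> are the
denominators of the \<open>P\<close>- and of the \<open>Q\<close>-product, so one family \<open>y\<close> of spectral parameters serves both.\<close>

definition R :: "('i \<Rightarrow> complex) \<Rightarrow> 'i \<Rightarrow> 'i \<Rightarrow> 'a" where
  "R y k l = 1 - inverse (y k - y l) *s P k l"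

definition B :: "('i \<Rightarrow> complex) \<Rightarrow> 'i \<Rightarrow> 'i \<Rightarrow> 'a" where
  "B y k l = 1 - inverse (y k + y l) *s Q k l"

lemma B_sym: "B y k l = B y l k"
  using Q_sym[of k l] by (simp add: B_def add.commute)

lemma one_minus_commute:
  assumes "X * Y = Y * X"
  shows "(1 - a *s X) * (1 - b *s Y) = (1 - b *s Y) * (1 - a *s X)"
  using assms by (simp add: algebra_simps)

lemma R_R_commute:
  assumes "distinct [i, j, k, l]" "{i, j, k, l} \<subseteq> I"
  shows "R y i j * R z k l = R z k l * R y i j"
  unfolding R_def by (intro one_minus_commute P_P_commute assms)

lemma B_R_commute:
  assumes "distinct [i, j, k, l]" "{i, j, k, l} \<subseteq> I"
  shows "B y i j * R z k l = R z k l * B y i j"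
  unfolding R_def B_def by (intro one_minus_commute Q_P_commute assms)

lemma B_B_commute:
  assumes "distinct [i, j, k, l]" "{i, j, k, l} \<subseteq> I"
  shows "B y i j * B z k l = B z k l * B y i j"
  unfolding B_def by (intro one_minus_commute Q_Q_commute assms)

lemma B_R_commute_same:
  assumes "k \<in> I" "l \<in> I" "k \<noteq> l"
  shows "B y k l * R z k l = R z k l * B y k l"
  unfolding R_def B_def using assms by (intro one_minus_commute) (simp add: Q_P P_Q)

lemma triple_product:
  "(1 - a *s X) * (1 - b *s Y) * (1 - c *s Z) =
    1 - a *s X - b *s Y - c *s Z + (a * b) *s (X * Y) + (a * c) *s (X * Z) + (b * c) *s (Y * Z)
      - (a * b * c) *s (X * Y * Z)"
  by (simp add: algebra_simps)

text \<open>The three double products on either side reduce to the two 3-cycles \<open>U\<close> and \<open>V\<close>, and the triple products to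
\<open>P\<^sub>j\<^sub>l\<close>. What remains is the identity \<open>a b + b c = a c\<close> between the coefficients.\<close>

lemma yang_baxter:
  assumes d: "distinct [j, k, l]" "{j, k, l} \<subseteq> I" and y: "inj_on y {j, k, l}"
  shows "R y j k * R y j l * R y k l = R y k l * R y j l * R y j k"
proof -
  define a b c where "a = inverse (y j - y k)" and "b = inverse (y j - y l)"
    and "c = inverse (y k - y l)"
  have "y j \<noteq> y k" "y j \<noteq> y l" "y k \<noteq> y l"
    using y d by (auto simp: inj_on_def)
  then have abc: "a * b + b * c = a * c"
    unfolding a_def b_def c_def by (simp add: divide_simps)
  define U V where "U = P j k * P j l" and "V = P j k * P k l"
  have 1: "P j l * P k l = U" "P k l * P j k = U"
    using P_conj[of l j k] P_conj[of j k l] d unfolding U_def by (auto simp: P_sym)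
  have 2: "P k l * P j l = V" "P j l * P j k = V"
    using P_conj[of l k j] P_conj[of j l k] P_conj[of k j l] d unfolding V_def by (auto simp: P_sym)
  have PP: "P i i' * (P i i' * X) = X" if "i \<in> I" "i' \<in> I" "i \<noteq> i'" for i i' X
    using P_P[OF that] by (simp add: mult.assoc[symmetric])
  have 3: "U * P k l = P j l"
    using 1 PP[of j k "P j l"] d by (simp add: mult.assoc U_def)
  have 4: "V * P j k = P j l"
  proof -
    have "V * P j k = P k l * V"
      by (subst 2(1)[symmetric], subst mult.assoc, subst 2(2), rule refl)
    then show ?thesis
      using PP[of k l "P j l"] d unfolding 2(1) by simp
  qed
  have 5: "P j k * P j l = U" "P j k * P k l = V"
    by (simp_all add: U_def V_def)
  have "R y j k * R y j l * R y k l = 1 - a *s P j k - b *s P j l - c *s P k l + (a * b + b * c) *s U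
      + (a * c) *s V - (a * b * c) *s P j l"
    unfolding R_def a_def[symmetric] b_def[symmetric] c_def[symmetric] triple_product 3 1 5
    by (simp add: scale_left_distrib)
  also have "\<dots> = 1 - a *s P j k - b *s P j l - c *s P k l + (a * c) *s U
      + (a * b + b * c) *s V - (a * b * c) *s P j l"
    unfolding abc ..
  also have "\<dots> = R y k l * R y j l * R y j k"
    unfolding R_def a_def[symmetric] b_def[symmetric] c_def[symmetric] triple_product 4 1 2
    by (simp add: scale_left_distrib mult.commute mult.left_commute)
  finally show ?thesis .
qed

text \<open>The computation is parallel to the one for three \<open>P\<close>-factors: \<open>U = Q\<^sub>j\<^sub>k P\<^sub>k\<^sub>l\<close> and \<open>V = Q\<^sub>j\<^sub>l P\<^sub>k\<^sub>l\<close> take the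
place of the 3-cycles, and the coefficients satisfy \<open>a b + a c = b c\<close>.\<close>

lemma reflected_yang_baxter:
  assumes d: "distinct [j, k, l]" "{j, k, l} \<subseteq> I"
    and y: "y j + y k \<noteq> 0" "y j + y l \<noteq> 0" "y k \<noteq> y l"
  shows "B y j k * B y j l * R y k l = R y k l * B y j l * B y j k"
proof -
  define a b c where "a = inverse (y j + y k)" and "b = inverse (y j + y l)"
    and "c = inverse (y k - y l)"
  have abc: "a * b + a * c = b * c"
    using y unfolding a_def b_def c_def by (simp add: divide_simps)
  define U V where "U = Q j k * P k l" and "V = Q j l * P k l"
  have 1: "Q j k * Q j l = U" "Q j k * P k l = U" "P k l * Q j l = U"
    using Q_Q[of j k l] P_Q_conj[of l k j] d unfolding U_def by (auto simp: Q_sym P_sym)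
  have 2: "Q j l * Q j k = V" "Q j l * P k l = V" "P k l * Q j k = V"
    using Q_Q[of j l k] P_Q_conj[of k l j] d unfolding V_def by (auto simp: Q_sym P_sym)
  have PP: "X * P k l * P k l = X" for X
    using P_P[of k l] d by (simp add: mult.assoc)
  have 3: "U * P k l = Q j k"
    using PP by (simp add: U_def)
  have 4: "U * Q j k = Q j k"
  proof -
    have "U * Q j k = Q j k * V" by (simp add: U_def 2 mult.assoc)
    also have "\<dots> = U * P k l" by (simp add: V_def 1 mult.assoc[symmetric])
    finally show ?thesis using 3 by simp
  qed
  have "B y j k * B y j l * R y k l = 1 - a *s Q j k - b *s Q j l - c *s P k l + (a * b + a * c) *s U
      + (b * c) *s V - (a * b * c) *s Q j k"
    unfolding R_def B_def a_def[symmetric] b_def[symmetric] c_def[symmetric] triple_product 1 2 3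
    by (simp add: scale_left_distrib)
  also have "\<dots> = 1 - a *s Q j k - b *s Q j l - c *s P k l + (b * c) *s U
      + (a * b + a * c) *s V - (a * b * c) *s Q j k"
    unfolding abc ..
  also have "\<dots> = R y k l * B y j l * B y j k"
    unfolding R_def B_def a_def[symmetric] b_def[symmetric] c_def[symmetric] triple_product 4 1 2
    by (simp add: scale_left_distrib mult.commute mult.left_commute)
  finally show ?thesis .
qed

lemma fusion_eq_rev_fusion:
  assumes "distinct xs" "set xs \<subseteq> I" "inj_on y (set xs)"
  shows "pair_prod (R y) xs = rev_pair_prod (R y) xs"
  using assms by (intro pair_prod_eq_rev_pair_prod yang_baxter R_R_commute) (auto simp: inj_on_def)

lemma B_fusion_exchange:
  assumes xs: "distinct xs" "set xs \<subseteq> I" and y: "inj_on y (set xs)"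
    and yy: "\<And>k l. k \<in> set xs \<Longrightarrow> l \<in> set xs \<Longrightarrow> k \<noteq> l \<Longrightarrow> y k + y l \<noteq> 0"
  shows "pair_prod (B y) xs * pair_prod (R y) xs = pair_prod (R y) xs * rev_pair_prod (B y) xs"
proof (rule pair_prods_exchange)
  fix i j k l
  show "B y k l = B y l k"
    by (rule B_sym)
  show "B y k l * R y k l = R y k l * B y k l" if "k \<in> set xs" "l \<in> set xs" "k \<noteq> l"
    using that xs by (intro B_R_commute_same) auto
  show "R y j k * R y j l * R y k l = R y k l * R y j l * R y j k"
    if "distinct [j, k, l]" "{j, k, l} \<subseteq> set xs"
    using that xs y by (intro yang_baxter) (auto simp: inj_on_def)
  show "B y j k * B y j l * R y k l = R y k l * B y j l * B y j k"
    if "distinct [j, k, l]" "{j, k, l} \<subseteq> set xs"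
    using that xs y by (intro reflected_yang_baxter yy) (auto simp: inj_on_def)
  show "R y i j * R y k l = R y k l * R y i j" "B y i j * R y k l = R y k l * B y i j"
    "B y i j * B y k l = B y k l * B y i j"
    if "distinct [i, j, k, l]" "{i, j, k, l} \<subseteq> set xs"
    using that xs by (auto intro!: R_R_commute B_R_commute B_B_commute)
qed (use xs in auto)

lemma slide_R:
  assumes "distinct C" "set C \<subseteq> I" "k \<in> I" "k \<notin> set C" and y: "inj_on y (insert k (set C))"
  shows "(\<Prod>l\<leftarrow>C. R y k l) * pair_prod (R y) C = pair_prod (R y) C * (\<Prod>l\<leftarrow>rev C. R y k l)"
  using assms by (intro slide yang_baxter R_R_commute) (auto simp: inj_on_def)

lemma slide_B:
  assumes "distinct C" "set C \<subseteq> I" "k \<in> I" "k \<notin> set C" and y: "inj_on y (set C)"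
    and yy: "\<And>l. l \<in> set C \<Longrightarrow> y k + y l \<noteq> 0"
  shows "(\<Prod>l\<leftarrow>C. B y k l) * pair_prod (R y) C = pair_prod (R y) C * (\<Prod>l\<leftarrow>rev C. B y k l)"
  using assms by (intro slide reflected_yang_baxter B_R_commute) (auto simp: inj_on_def)

subsection \<open>Columns: antisymmetry and cancellation of poles\<close>

text \<open>The entries of a column, read downwards: their spectral parameters decrease by one, since the contents do
and the variables \<open>t\<^sub>k\<close> agree.\<close>

definition column :: "('i \<Rightarrow> complex) \<Rightarrow> 'i list \<Rightarrow> bool" where
  "column y C \<longleftrightarrow> distinct C \<and> set C \<subseteq> I \<and> inj_on y (set C) \<and> successively (\<lambda>k l. y k - y l = 1) C"

lemma column_Cons:
  assumes "column y (k # C)"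
  shows "column y C" "k \<in> I" "k \<notin> set C" "inj_on y (insert k (set C))" "distinct C" "set C \<subseteq> I"
  using assms by (cases C; auto simp: column_def intro: inj_on_subset)+

text \<open>For neighbours at the start of the column the leading factor is \<open>1 - P\<^sub>k\<^sub>l\<close>, which \<open>P\<^sub>k\<^sub>l\<close> turns into its
negative. Pairs further down are reached after sliding the first row to the right end of the product, and
the remaining transpositions are conjugates of these.\<close>

lemma column_antisymmetric:
  assumes "column y C" "k \<in> set C" "l \<in> set C" "k \<noteq> l"
  shows "P k l * pair_prod (R y) C = - pair_prod (R y) C"
  using assms
proof (induction C arbitrary: k l)
  case (Cons b C)
  note C = column_Cons[OF Cons.prems(1)]
  let ?A = "pair_prod (R y) (b # C)"
  have slide: "?A = pair_prod (R y) C * (\<Prod>l\<leftarrow>rev C. R y b l)"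
    using slide_R[OF C(5,6,2,3,4)] by simp
  have inner: "P k l * ?A = - ?A" if "k \<in> set C" "l \<in> set C" "k \<noteq> l" for k l
  proof -
    have "P k l * ?A = (P k l * pair_prod (R y) C) * (\<Prod>l\<leftarrow>rev C. R y b l)"
      unfolding slide by (simp only: mult.assoc)
    then show ?thesis
      unfolding slide Cons.IH[OF C(1) that] by simp
  qed
  have outer: "P b l * ?A = - ?A" if l: "l \<in> set C" for l
  proof -
    obtain b' C' where C': "C = b' # C'"
      using l by (cases C) auto
    have b': "b' \<in> I" "b \<noteq> b'" "y b - y b' = 1"
      using C C' Cons.prems(1) by (auto simp: column_def)
    have "P b b' * R y b b' = - R y b b'"
      using b' C(2) P_P[of b b'] by (simp add: R_def algebra_simps)
    then have first: "P b b' * ?A = - ?A"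
      by (simp add: C' mult.assoc[symmetric])
    show ?thesis
    proof (cases "l = b'")
      case False
      have "P b' l * P b' b = P l b * P b' l"
        using l C C' False b' by (intro P_conj) auto
      then have "P b l = P b' l * P b b' * P b' l"
        using P_P[of b' l] l C C' False b' by (auto simp: P_sym mult.assoc)
      then show ?thesis
        using first inner[of b' l] l C' False by (simp add: mult.assoc)
    qed (use first in simp)
  qed
  show ?case
    using Cons.prems inner[of k l] outer[of k] outer[of l] P_sym[of k l] by auto
qed simp

text \<open>\<open>Q\<^sub>k\<^sub>l\<close> is symmetric and the product over the column is antisymmetric in \<open>k\<close> and \<open>l\<close>, so \<open>Q\<^sub>k\<^sub>l\<close> annihilates it.\<close>

lemma B_absorbed_by_column:
  assumes "column y C" "k \<in> set C" "l \<in> set C" "k \<noteq> l"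
  shows "B z k l * pair_prod (R y) C = pair_prod (R y) C"
proof -
  let ?X = "Q k l * pair_prod (R y) C"
  have "?X = Q k l * (P k l * pair_prod (R y) C)"
    using Q_P[of k l] assms by (simp add: column_def mult.assoc[symmetric] subset_iff)
  also have "\<dots> = - ?X"
    unfolding column_antisymmetric[OF assms] by simp
  finally have "?X + ?X = 0"
    by (metis add.right_inverse)
  \<comment> \<open>Scalars may be divided by 2, so \<open>X = - X\<close> forces \<open>X = 0\<close>.\<close>
  then have "(1 / 2) *s (?X + ?X) = 0"
    by simp
  then have "?X = 0"
    by (simp add: scale_right_distrib scale_left_distrib[symmetric])
  then show ?thesis
    by (simp add: B_def algebra_simps)
qed

text \<open>What the factors \<open>R\<^sub>k\<^sub>l\<close>, \<open>l \<in> C\<close>, amount to in front of the antisymmetrizer of the column \<open>C\<close>. For an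
empty column the sum is 0, so the value of \<open>hd []\<close> is harmless.\<close>

definition column_factor :: "('i \<Rightarrow> complex) \<Rightarrow> 'i \<Rightarrow> 'i list \<Rightarrow> 'a" where
  "column_factor y k C = 1 - inverse (y k - y (hd C)) *s (\<Sum>l\<leftarrow>C. P k l)"

text \<open>On antisymmetric tensors \<open>P\<^sub>k\<^sub>b P\<^sub>k\<^sub>l = P\<^sub>k\<^sub>l P\<^sub>l\<^sub>b\<close> acts as \<open>- P\<^sub>k\<^sub>l\<close>. Hence multiplying
\<open>1 - v \<Sum> P\<^sub>k\<^sub>l\<close> by one more factor \<open>1 - u P\<^sub>k\<^sub>b\<close> from above changes the coefficient \<open>v\<close> of the old terms
to \<open>v + u v\<close>, which is \<open>u\<close> as \<open>1/v = 1/u + 1\<close>: the pole moves up to the new top entry.\<close>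

lemma column_pole_cancellation:
  assumes "column y C" "k \<in> I" "k \<notin> set C" "\<And>l. l \<in> set C \<Longrightarrow> y k \<noteq> y l"
  shows "(\<Prod>l\<leftarrow>C. R y k l) * pair_prod (R y) C = column_factor y k C * pair_prod (R y) C"
  using assms
proof (induction C)
  case (Cons b C)
  note C = column_Cons[OF Cons.prems(1)]
  let ?A = "pair_prod (R y) (b # C)"
  show ?case
  proof (cases C)
    case Nil
    then show ?thesis by (simp add: R_def column_factor_def)
  next
    case (Cons b' C')
    define u v where "u = inverse (y k - y b)" and "v = inverse (y k - y b')"
    define X where "X = (\<Sum>l\<leftarrow>C. P k l)"
    have "y b = y b' + 1"
      using Cons.prems(1) Cons by (simp add: column_def algebra_simps)
    moreover have "y k \<noteq> y b" "y k \<noteq> y b'"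
      using Cons.prems(4) Cons by auto
    ultimately have uv: "v + u * v = u"
      unfolding u_def v_def by (simp add: divide_simps)
    have slide: "?A = pair_prod (R y) C * (\<Prod>l\<leftarrow>rev C. R y b l)"
      using slide_R[OF C(5,6,2,3,4)] by simp
    have IH: "(\<Prod>l\<leftarrow>C. R y k l) * ?A = column_factor y k C * ?A"
    proof -
      have "(\<Prod>l\<leftarrow>C. R y k l) * pair_prod (R y) C = column_factor y k C * pair_prod (R y) C"
        using Cons.prems by (intro Cons.IH C) auto
      then show ?thesis
        unfolding slide by (simp only: mult.assoc[symmetric])
    qed
    have S: "column_factor y k C = 1 - v *s X" "column_factor y k (b # C) = 1 - u *s (P k b + X)"
      by (simp_all add: column_factor_def u_def v_def X_def Cons)
    have "P k b * (P k l * ?A) = - (P k l * ?A)" if l: "l \<in> set C" for l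
    proof -
      have "P l k * P l b = P k b * P l k"
        using l Cons.prems C by (intro P_conj) auto
      moreover have "P b l * ?A = - ?A"
        using l C Cons.prems(1) by (intro column_antisymmetric) auto
      ultimately show ?thesis
        by (metis P_sym mult.assoc mult_minus_right)
    qed
    then have "P k b * (X * ?A) = - (X * ?A)"
      unfolding X_def sum_list_mult_const[symmetric] sum_list_const_mult[symmetric] uminus_sum_list_map o_def
      by (intro arg_cong[of _ _ sum_list] map_cong) auto
    then have "(1 - u *s P k b) * ((1 - v *s X) * ?A) = ?A - u *s (P k b * ?A) - (v + u * v) *s (X * ?A)"
      by (simp add: left_diff_distrib right_diff_distrib scale_left_distrib scale_right_distrib mult.assoc
          mult.commute[of v u] del: pair_prod.simps)
    also have "\<dots> = column_factor y k (b # C) * ?A"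
      unfolding uv S by (simp add: algebra_simps del: pair_prod.simps)
    finally have "R y k b * (column_factor y k C * ?A) = column_factor y k (b # C) * ?A"
      unfolding S by (simp only: R_def[of y k b] u_def)
    then show ?thesis
      unfolding IH[symmetric] by (simp only: list.map prod_list.Cons mult.assoc)
  qed
qed (simp add: column_factor_def)

text \<open>Conjugation by \<open>P\<^sub>i\<^sub>j\<close> permutes the summands.\<close>

lemma sum_P_commute:
  assumes "distinct C" "set C \<subseteq> I" "k \<in> I" "k \<notin> set C" "i \<in> set C" "j \<in> set C" "i \<noteq> j"
  shows "P i j * (\<Sum>l\<leftarrow>C. P k l) = (\<Sum>l\<leftarrow>C. P k l) * P i j"
proof -
  have ij: "i \<noteq> k" "j \<noteq> k" "i \<in> I" "j \<in> I"
    using assms by auto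
  have *: "P i j * P k l = P k (transpose i j l) * P i j" if "l \<in> set C" for l
  proof (cases "l = i \<or> l = j")
    case True
    then show ?thesis
      using P_conj[of i j k] P_conj[of j i k] P_sym[of i k] P_sym[of j k] assms ij
      by (auto simp: P_sym[of j i])
  next
    case False
    then show ?thesis
      using P_P_commute[of i j k l] assms that by (auto simp: transpose_def)
  qed
  have bij: "bij_betw (transpose i j) (set C) (set C)"
    using assms by (intro bij_betw_byWitness[where f' = "transpose i j"]) (auto simp: transpose_def)
  have "P i j * (\<Sum>l\<in>set C. P k l) = (\<Sum>l\<in>set C. P k (transpose i j l) * P i j)"
    unfolding sum_distrib_left using * by (intro sum.cong) auto
  also have "\<dots> = (\<Sum>l\<in>set C. P k l) * P i j"
    unfolding sum_distrib_right using sum.reindex_bij_betw[OF bij, of "\<lambda>l. P k l * P i j"] .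
  finally show ?thesis
    using assms by (simp add: sum_list_distinct_conv_sum_set)
qed

lemma column_factor_commute:
  assumes "distinct C" "set C \<subseteq> I" "k \<in> I" "k \<notin> set C"
  shows "column_factor y k C * pair_prod (R z) C = pair_prod (R z) C * column_factor y k C"
  using assms unfolding column_factor_def
  by (intro pair_prod_commute) (auto simp: R_def intro!: one_minus_commute sum_P_commute[symmetric])

lemma column_factor_commute_disjoint:
  assumes "distinct C'" "set C \<subseteq> I" "set C' \<subseteq> I" "k \<in> I" "k \<notin> set C'" "k \<notin> set C" "set C \<inter> set C' = {}"
  shows "column_factor y k C * pair_prod (R z) C' = pair_prod (R z) C' * column_factor y k C"
proof (rule pair_prod_commute)
  fix i j assume ij: "i \<in> set C'" "j \<in> set C'" "i \<noteq> j"
  have "P k l * P i j = P i j * P k l" if "l \<in> set C" for l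
    using ij assms that by (intro P_P_commute) auto
  then have "(\<Sum>l\<leftarrow>C. P k l) * P i j = P i j * (\<Sum>l\<leftarrow>C. P k l)"
    unfolding sum_list_mult_const[symmetric] sum_list_const_mult[symmetric]
    by (intro arg_cong[of _ _ sum_list] map_cong) auto
  then show "column_factor y k C * R z i j = R z i j * column_factor y k C"
    unfolding column_factor_def R_def by (intro one_minus_commute)
qed fact

definition antisymmetrizer :: "('i \<Rightarrow> complex) \<Rightarrow> 'i list list \<Rightarrow> 'a" where
  "antisymmetrizer y cs = (\<Prod>C\<leftarrow>cs. pair_prod (R y) C)"

text \<open>The product of the factors for each entry \<open>k\<close> and each later column, in the order in which they arise from
the lexicographic product.\<close>

primrec column_factors :: "('i \<Rightarrow> complex) \<Rightarrow> 'i list list \<Rightarrow> 'a" where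
  "column_factors y [] = 1"
| "column_factors y (C # cs) = (\<Prod>k\<leftarrow>C. \<Prod>C'\<leftarrow>cs. column_factor y k C') * column_factors y cs"

lemma row_times_antisymmetrizer:
  assumes "distinct (concat cs)" "\<And>C. C \<in> set cs \<Longrightarrow> column y C" "k \<in> I" "k \<notin> set (concat cs)"
    and "\<And>l. l \<in> set (concat cs) \<Longrightarrow> y k \<noteq> y l"
  shows "(\<Prod>l\<leftarrow>concat cs. R y k l) * antisymmetrizer y cs =
    antisymmetrizer y cs * (\<Prod>C\<leftarrow>cs. column_factor y k C)"
  using assms
proof (induction cs)
  case (Cons C cs)
  let ?T = "\<Prod>l\<leftarrow>C. R y k l" and ?U = "\<Prod>l\<leftarrow>concat cs. R y k l" and ?A = "pair_prod (R y) C"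
  let ?W = "\<Prod>C\<leftarrow>cs. column_factor y k C"
  have C: "distinct C" "set C \<subseteq> I"
    using Cons.prems(2)[of C] by (auto simp: column_def)
  have cs: "distinct C'" "set C' \<subseteq> I" "set C \<inter> set C' = {}" "k \<notin> set C'" if "C' \<in> set cs" for C'
    using Cons.prems(1,4) Cons.prems(2)[of C'] that by (auto simp: column_def)
  have 1: "?U * ?A = ?A * ?U"
    using C cs Cons.prems(1,3,4)
    by (intro prod_list_intertwine pair_prod_commute R_R_commute) auto
  have 2: "?T * ?A = ?A * column_factor y k C"
    using column_pole_cancellation[of y C k] column_factor_commute[of C k y y] C Cons.prems by auto
  have 3: "column_factor y k C * antisymmetrizer y cs = antisymmetrizer y cs * column_factor y k C"
    unfolding antisymmetrizer_def using C cs Cons.prems(3,4)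
    by (intro prod_list_commute column_factor_commute_disjoint) auto
  have IH: "?U * antisymmetrizer y cs = antisymmetrizer y cs * ?W"
    using Cons.prems by (intro Cons.IH) auto
  have "(\<Prod>l\<leftarrow>concat (C # cs). R y k l) * antisymmetrizer y (C # cs) =
      ?T * (?U * ?A) * antisymmetrizer y cs"
    by (simp add: antisymmetrizer_def mult.assoc)
  also have "\<dots> = (?T * ?A) * (?U * antisymmetrizer y cs)"
    unfolding 1 by (simp add: mult.assoc)
  also have "\<dots> = ?A * (column_factor y k C * antisymmetrizer y cs) * ?W"
    unfolding 2 IH by (simp add: mult.assoc)
  finally show ?case
    unfolding 3 by (simp add: antisymmetrizer_def mult.assoc)
qed (simp add: antisymmetrizer_def)

text \<open>Induction on the list of columns. In the product over \<open>C\<close> followed by the later columns, the rectangular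
block is a product of rows, each of which turns into column factors as it passes the antisymmetrizers of the
later columns.\<close>

lemma fusion_factorization:
  assumes "distinct (concat cs)" "\<And>C. C \<in> set cs \<Longrightarrow> column y C" "inj_on y (set (concat cs))"
  shows "pair_prod (R y) (concat cs) = antisymmetrizer y cs * column_factors y cs"
  using assms
proof (induction cs)
  case (Cons C cs)
  let ?A = "antisymmetrizer y cs" and ?X = "\<Prod>k\<leftarrow>C. \<Prod>l\<leftarrow>concat cs. R y k l"
  have I: "set C \<subseteq> I" "set (concat cs) \<subseteq> I"
    using Cons.prems(2) by (auto simp: column_def)
  have "pair_prod (R y) (C @ concat cs) = pair_prod (R y) C * ?X * pair_prod (R y) (concat cs)"
    using Cons.prems(1) I by (intro pair_prod_append R_R_commute) auto
  also have "pair_prod (R y) (concat cs) = ?A * column_factors y cs"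
    using Cons.prems by (intro Cons.IH) (auto intro: inj_on_subset)
  also have "pair_prod (R y) C * ?X * (?A * column_factors y cs) = pair_prod (R y) C * (?X * ?A) * column_factors y cs"
    by (simp add: mult.assoc)
  also have "?X * ?A = ?A * (\<Prod>k\<leftarrow>C. \<Prod>C'\<leftarrow>cs. column_factor y k C')"
  proof (intro prod_list_intertwine row_times_antisymmetrizer)
    fix k l assume "k \<in> set C" "l \<in> set (concat cs)"
    moreover have "k \<noteq> l"
      using Cons.prems(1) calculation by auto
    ultimately show "y k \<noteq> y l"
      using Cons.prems(3) by (auto simp: inj_on_def)
  qed (use Cons.prems I in auto)
  finally show ?case
    by (simp add: antisymmetrizer_def mult.assoc)
qed (simp add: antisymmetrizer_def)

text \<open>The block between \<open>C\<close> and the later columns, ordered by the later index first, consists of families indexed by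
\<open>C\<close>, which slide through the antisymmetrizer of \<open>C\<close>. So this antisymmetrizer can be moved next to the
factors inside \<open>C\<close>, absorb them, and be moved back.\<close>

lemma reduced_B_product:
  assumes "distinct (concat cs)" "\<And>C. C \<in> set cs \<Longrightarrow> column y C"
    and yy: "\<And>k l. k \<in> set (concat cs) \<Longrightarrow> l \<in> set (concat cs) \<Longrightarrow> k \<noteq> l \<Longrightarrow> y k + y l \<noteq> 0"
    and same: "\<And>C k l. C \<in> set cs \<Longrightarrow> k \<in> set C \<Longrightarrow> l \<in> set (concat cs) \<Longrightarrow> same k l \<longleftrightarrow> l \<in> set C"
  shows "pair_prod (B y) (concat cs) * antisymmetrizer y cs =
    pair_prod (\<lambda>k l. if same k l then 1 else B y k l) (concat cs) * antisymmetrizer y cs"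
  using assms
proof (induction cs)
  case (Cons C cs)
  define B' where "B' = (\<lambda>k l. if same k l then 1 else B y k l)"
  let ?D = "concat cs" and ?A = "pair_prod (R y) C"
  let ?X = "\<Prod>k\<leftarrow>C. \<Prod>l\<leftarrow>?D. B y k l"
  have C: "distinct C" "set C \<subseteq> I" "inj_on y (set C)" "column y C"
    using Cons.prems(2)[of C] by (auto simp: column_def)
  have D: "distinct ?D" "set ?D \<subseteq> I" "set C \<inter> set ?D = {}"
    using Cons.prems(1,2) by (auto simp: column_def)
  have B': "B' k l = 1" if "k \<in> set C" "l \<in> set C" for k l
    using Cons.prems(4)[of C k l] that by (auto simp: B'_def)
  have B'': "B' k l = B y k l" if "k \<in> set C" "l \<in> set ?D" for k l
    using Cons.prems(4)[of C k l] D that by (auto simp: B'_def)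
  have split: "pair_prod (B y) (C @ ?D) = pair_prod (B y) C * ?X * pair_prod (B y) ?D"
    using C D by (intro pair_prod_append B_B_commute) auto
  have "pair_prod B' (C @ ?D) = pair_prod B' C * (\<Prod>k\<leftarrow>C. \<Prod>l\<leftarrow>?D. B' k l) * pair_prod B' ?D"
    using C D by (intro pair_prod_append) (auto simp: B'_def intro!: B_B_commute)
  also have "(\<Prod>k\<leftarrow>C. \<Prod>l\<leftarrow>?D. B' k l) = ?X"
    using B'' by (intro arg_cong[of _ _ prod_list] map_cong) auto
  also have "pair_prod B' C = 1"
    using pair_prod_absorb[of C B' 1] C B' by simp
  finally have split': "pair_prod B' (C @ ?D) = ?X * pair_prod B' ?D"
    by simp
  have "?X = (\<Prod>l\<leftarrow>?D. \<Prod>k\<leftarrow>C. B y k l)"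
    using C D by (intro prod_list_swap B_B_commute) auto
  also have "\<dots> = (\<Prod>l\<leftarrow>?D. \<Prod>k\<leftarrow>C. B y l k)"
    by (intro arg_cong[of _ _ prod_list] map_cong refl B_sym)
  finally have swap: "?X = (\<Prod>l\<leftarrow>?D. \<Prod>k\<leftarrow>C. B y l k)" .
  have "y l + y k \<noteq> 0" if "k \<in> set C" "l \<in> set ?D" for k l
    using that D by (intro Cons.prems(3)) auto
  then have XA: "?X * ?A = ?A * (\<Prod>l\<leftarrow>?D. \<Prod>k\<leftarrow>rev C. B y l k)"
    unfolding swap using C D by (intro prod_list_intertwine slide_B) auto
  have absorb: "pair_prod (B y) C * ?A = ?A"
    using C by (intro pair_prod_absorb B_absorbed_by_column) auto
  have B_A: "?A * B y k l = B y k l * ?A" if kl: "k \<in> set ?D" "l \<in> set ?D" "k \<noteq> l" for k l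
  proof (rule pair_prod_commute[symmetric, OF C(1)])
    have "k \<in> I" "l \<in> I" "k \<notin> set C" "l \<notin> set C"
      using kl D(2,3) by blast+
    then show "B y k l * R y i j = R y i j * B y k l" if "i \<in> set C" "j \<in> set C" "i \<noteq> j" for i j
      using that kl(3) C(2) by (intro B_R_commute) auto
  qed
  have comm: "pair_prod (B y) ?D * ?A = ?A * pair_prod (B y) ?D"
    by (rule pair_prod_commute[OF D(1), symmetric]) (rule B_A)
  have B'_A: "?A * B' k l = B' k l * ?A" if "k \<in> set ?D" "l \<in> set ?D" "k \<noteq> l" for k l
    using B_A[OF that] by (simp add: B'_def)
  have comm': "pair_prod B' ?D * ?A = ?A * pair_prod B' ?D"
    by (rule pair_prod_commute[OF D(1), symmetric]) (rule B'_A)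
  have IH: "pair_prod (B y) ?D * antisymmetrizer y cs = pair_prod B' ?D * antisymmetrizer y cs"
    unfolding B'_def using Cons.prems by (intro Cons.IH) auto
  have "pair_prod (B y) (concat (C # cs)) * antisymmetrizer y (C # cs) =
      pair_prod (B y) C * ?X * (pair_prod (B y) ?D * ?A) * antisymmetrizer y cs"
    using split by (simp add: antisymmetrizer_def mult.assoc)
  also have "\<dots> = pair_prod (B y) C * (?X * ?A) * (pair_prod (B y) ?D * antisymmetrizer y cs)"
    unfolding comm by (simp add: mult.assoc)
  also have "\<dots> = (pair_prod (B y) C * ?A) * (\<Prod>l\<leftarrow>?D. \<Prod>k\<leftarrow>rev C. B y l k) *
      (pair_prod B' ?D * antisymmetrizer y cs)"
    unfolding XA IH by (simp add: mult.assoc)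
  also have "\<dots> = (?X * ?A) * (pair_prod B' ?D * antisymmetrizer y cs)"
    unfolding absorb XA ..
  also have "\<dots> = ?X * (pair_prod B' ?D * ?A) * antisymmetrizer y cs"
    unfolding comm' by (simp add: mult.assoc)
  also have "\<dots> = pair_prod B' (concat (C # cs)) * antisymmetrizer y (C # cs)"
    using split' by (simp add: antisymmetrizer_def mult.assoc)
  finally show ?case
    unfolding B'_def .
qed simp

end

section \<open>Linear operators on tensor powers\<close>

text \<open>Linear operators on coordinate functions form a ring. The type lets ring identities be proved by rewriting;
operators on tensors are not restricted to the finite-dimensional space \<open>tensors n N\<close>, since the relations
between \<open>P\<^sub>k\<^sub>l\<close> and \<open>Q\<^sub>k\<^sub>l\<close> hold for all coordinate functions.\<close>

typedef 'i operator = "{f :: ('i \<Rightarrow> complex) \<Rightarrow> 'i \<Rightarrow> complex.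
    \<forall>c x y. f (\<lambda>a. c * x a + y a) = (\<lambda>a. c * f x a + f y a)}"
  morphisms apply_op Abs_operator
  by (intro exI[of _ "\<lambda>x. x"]) simp

setup_lifting type_definition_operator

instantiation operator :: (type) ring_1
begin

lift_definition zero_operator :: "'a operator" is "\<lambda>x a. 0" by simp
lift_definition one_operator :: "'a operator" is "\<lambda>x. x" by simp
lift_definition plus_operator :: "'a operator \<Rightarrow> 'a operator \<Rightarrow> 'a operator" is
  "\<lambda>f g x a. f x a + g x a" by (simp add: algebra_simps)
lift_definition uminus_operator :: "'a operator \<Rightarrow> 'a operator" is
  "\<lambda>f x a. - f x a" by simp
lift_definition minus_operator :: "'a operator \<Rightarrow> 'a operator \<Rightarrow> 'a operator" is
  "\<lambda>f g x a. f x a - g x a" by (simp add: algebra_simps)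
lift_definition times_operator :: "'a operator \<Rightarrow> 'a operator \<Rightarrow> 'a operator" is
  "\<lambda>f g x. f (g x)" by simp

lemma apply_op_linear: "apply_op f (\<lambda>a. c * x a + y a) = (\<lambda>a. c * apply_op f x a + apply_op f y a)"
  using apply_op[of f] by blast

lemma apply_op_add: "apply_op f (\<lambda>a. x a + y a) = (\<lambda>a. apply_op f x a + apply_op f y a)"
  using apply_op_linear[of f 1 x y] by simp

lemma apply_op_zero: "apply_op f (\<lambda>a. 0) = (\<lambda>a. 0)"
  using apply_op_linear[of f "-1" "\<lambda>a. 0" "\<lambda>a. 0"] by simp

lemma apply_op_scale: "apply_op f (\<lambda>a. c * x a) = (\<lambda>a. c * apply_op f x a)"
  using apply_op_linear[of f c x "\<lambda>a. 0"] by (simp add: apply_op_zero)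

instance
proof
  fix f g h :: "'a operator"
  show "f * g * h = f * (g * h)" "f + g + h = f + (g + h)" "f + g = g + f" "0 + f = f"
    "- f + f = 0" "f - g = f + - g" "1 * f = f" "f * 1 = f" "(f + g) * h = f * h + g * h"
    by (transfer; simp add: fun_eq_iff algebra_simps)+
  show "f * (g + h) = f * g + f * h"
    by (simp add: apply_op_inject[symmetric] times_operator.rep_eq plus_operator.rep_eq apply_op_add)
  show "(0 :: 'a operator) \<noteq> 1"
    by (transfer; auto simp: fun_eq_iff intro!: exI[of _ "\<lambda>_. 1"])
qed

end

lift_definition scale_op :: "complex \<Rightarrow> 'i operator \<Rightarrow> 'i operator" is
  "\<lambda>c f x a. c * f x a" by (simp add: algebra_simps)

lift_definition P_lin :: "nat \<Rightarrow> nat \<Rightarrow> (nat \<Rightarrow> nat) operator" is P_op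
  by (simp add: P_op_def)

lift_definition Q_lin :: "nat \<Rightarrow> nat \<Rightarrow> nat \<Rightarrow> nat \<Rightarrow> (nat \<Rightarrow> nat) operator" is Q_op
  by (auto simp: Q_op_def fun_eq_iff sum.distrib sum_distrib_left)

lemmas apply_op_simps = zero_operator.rep_eq one_operator.rep_eq plus_operator.rep_eq
  uminus_operator.rep_eq minus_operator.rep_eq times_operator.rep_eq scale_op.rep_eq
  P_lin.rep_eq Q_lin.rep_eq

lemma multi_indices_upd:
  assumes "a \<in> multi_indices n N" "k \<in> {1..n}" "i \<in> {1..N}"
  shows "a(k := i) \<in> multi_indices n N"
  using assms by (auto simp: multi_indices_def PiE_iff extensional_def)

lemma multi_indices_range:
  assumes "a \<in> multi_indices n N" "k \<in> {1..n}"
  shows "a k \<in> {1..N}"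
  using assms unfolding multi_indices_def by blast

lemma P_op_conj:
  assumes "distinct [j, k, l]"
  shows "P_op j k (P_op j l x) = P_op k l (P_op j k x)"
proof
  fix a :: "nat \<Rightarrow> nat"
  have "a \<circ> transpose j k \<circ> transpose j l = a \<circ> transpose k l \<circ> transpose j k"
    using assms by (auto simp: transpose_def fun_eq_iff)
  then show "P_op j k (P_op j l x) a = P_op k l (P_op j k x) a"
    by (simp add: P_op_def)
qed

lemma P_op_Q_op_conj:
  assumes "distinct [j, k, l]" "{j, k, l} \<subseteq> {1..n}"
  shows "P_op j k (Q_op n N j l x) = Q_op n N k l (P_op j k x)"
proof
  fix a :: "nat \<Rightarrow> nat"
  have "(a \<circ> transpose j k)(j := i, l := i) = a(k := i, l := i) \<circ> transpose j k" for i
    using assms by (auto simp: transpose_def fun_eq_iff)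
  then show "P_op j k (Q_op n N j l x) a = Q_op n N k l (P_op j k x) a"
    using assms multi_indices_transpose_iff[of j n k a N] by (simp add: P_op_def Q_op_def transpose_def)
qed

lemma P_op_Q_op_commute:
  assumes "distinct [i, j, k, l]" "{i, j, k, l} \<subseteq> {1..n}"
  shows "Q_op n N i j (P_op k l x) = P_op k l (Q_op n N i j x)"
proof
  fix a :: "nat \<Rightarrow> nat"
  have "(a \<circ> transpose k l)(i := s, j := s) = a(i := s, j := s) \<circ> transpose k l" for s
    using assms by (auto simp: transpose_def fun_eq_iff)
  then show "Q_op n N i j (P_op k l x) a = P_op k l (Q_op n N i j x) a"
    using assms multi_indices_transpose_iff[of k n l a N] by (simp add: P_op_def Q_op_def transpose_def)
qed

lemma Q_op_Q_op_commute:
  assumes "distinct [i, j, k, l]" "{i, j, k, l} \<subseteq> {1..n}"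
  shows "Q_op n N i j (Q_op n N k l x) = Q_op n N k l (Q_op n N i j x)"
proof
  fix a :: "nat \<Rightarrow> nat"
  have expand: "Q_op n N i j (Q_op n N k l x) a =
      (if a \<in> multi_indices n N \<and> a i = a j \<and> a k = a l
       then \<Sum>s = 1..N. \<Sum>r = 1..N. x (a(i := s, j := s, k := r, l := r)) else 0)"
    if d: "distinct [i, j, k, l]" "{i, j, k, l} \<subseteq> {1..n}" for i j k l
  proof (cases "a \<in> multi_indices n N")
    case True
    have "(a(i := s, j := s)) \<in> multi_indices n N" if "s \<in> {1..N}" for s
      using True d that by (simp add: multi_indices_upd)
    moreover have "(a(i := s, j := s)) k = a k" "(a(i := s, j := s)) l = a l" for s
      using d by simp_all
    ultimately show ?thesis
      using True by (auto simp: Q_op_def simp del: One_nat_def fun_upd_apply intro!: sum.cong)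
  qed (simp add: Q_op_def)
  have eq: "a(i := s, j := s, k := r, l := r) = a(k := r, l := r, i := s, j := s)" for s r
    using assms by (simp add: fun_upd_twist fun_eq_iff)
  show "Q_op n N i j (Q_op n N k l x) a = Q_op n N k l (Q_op n N i j x) a"
  proof (cases "a \<in> multi_indices n N \<and> a i = a j \<and> a k = a l")
    case True
    have "Q_op n N i j (Q_op n N k l x) a =
        (\<Sum>s = 1..N. \<Sum>r = 1..N. x (a(i := s, j := s, k := r, l := r)))"
      using True by (subst expand[OF assms]) simp
    also have "\<dots> = (\<Sum>r = 1..N. \<Sum>s = 1..N. x (a(k := r, l := r, i := s, j := s)))"
      unfolding eq by (rule sum.swap)
    also have "\<dots> = Q_op n N k l (Q_op n N i j x) a"
      using True assms by (subst expand) auto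
    finally show ?thesis .
  next
    case False
    have "Q_op n N k l (Q_op n N i j x) a = 0"
      using assms False by (subst expand) auto
    then show ?thesis
      using False by (subst expand[OF assms]) auto
  qed
qed

text \<open>\<open>Q\<^sub>j\<^sub>l\<close> puts the same basis vector into the factors \<open>j\<close> and \<open>l\<close>; contracting the factor \<open>j\<close> with \<open>k\<close> afterwards moves
the vector in the factor \<open>k\<close> to the factor \<open>l\<close>.\<close>

lemma Q_op_Q_op:
  assumes "distinct [j, k, l]" "{j, k, l} \<subseteq> {1..n}"
  shows "Q_op n N j k (Q_op n N j l x) = Q_op n N j k (P_op k l x)"
proof
  fix a :: "nat \<Rightarrow> nat"
  show "Q_op n N j k (Q_op n N j l x) a = Q_op n N j k (P_op k l x) a"
  proof (cases "a \<in> multi_indices n N \<and> a j = a k")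
    case True
    have al: "a l \<in> {1..N}"
      using True assms by (intro multi_indices_range[of a n N l]) auto
    have 1: "a(j := r, k := a l, l := r) = a(j := r, k := r) \<circ> transpose k l" for r
      using assms by (auto simp: fun_eq_iff transpose_def)
    have 2: "Q_op n N j l x (a(j := i, k := i)) =
        (if i = a l then \<Sum>r = 1..N. x (a(j := r, k := i, l := r)) else 0)" if "i \<in> {1..N}" for i
    proof -
      have "a(j := i, k := i) \<in> multi_indices n N"
        using True assms that by (intro multi_indices_upd) auto
      moreover have "a(j := i, k := i, j := r, l := r) = a(j := r, k := i, l := r)" for r
        using assms by (simp add: fun_eq_iff)
      moreover have "(a(j := i, k := i)) j = i" "(a(j := i, k := i)) l = a l"
        using assms by auto
      ultimately show ?thesis
        by (simp only: Q_op_def simp_thms)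
    qed
    have "Q_op n N j k (Q_op n N j l x) a =
        (\<Sum>i = 1..N. if i = a l then \<Sum>r = 1..N. x (a(j := r, k := i, l := r)) else 0)"
      using True by (subst Q_op_def) (simp add: 2 del: One_nat_def)
    also have "\<dots> = (\<Sum>r = 1..N. x (a(j := r, k := a l, l := r)))"
      using al by (subst sum.delta) auto
    finally show ?thesis
      using True by (simp add: Q_op_def P_op_def 1)
  qed (auto simp: Q_op_def)
qed

lemma brauer_relations_tensors:
  "brauer_relations scale_op P_lin (Q_lin n N) {1..n}"
proof
  fix c d :: complex and X Y :: "(nat \<Rightarrow> nat) operator"
  show "scale_op c (X + Y) = scale_op c X + scale_op c Y"
    "scale_op (c + d) X = scale_op c X + scale_op d X"
    "scale_op c (scale_op d X) = scale_op (c * d) X" "scale_op 1 X = X"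
    "scale_op c X * Y = scale_op c (X * Y)"
    by (simp_all add: apply_op_inject[symmetric] apply_op_simps fun_eq_iff algebra_simps)
  show "X * scale_op c Y = scale_op c (X * Y)"
    by (simp add: apply_op_inject[symmetric] apply_op_simps apply_op_scale)
next
  fix i j k l :: nat
  show "P_lin k l = P_lin l k"
    by (simp add: apply_op_inject[symmetric] apply_op_simps fun_eq_iff P_op_def transpose_commute)
  show "Q_lin n N k l = Q_lin n N l k"
  proof -
    have "a(k := i, l := i) = a(l := i, k := i)" for a :: "nat \<Rightarrow> nat" and i
      by (simp add: fun_eq_iff)
    then show ?thesis
      by (auto simp: apply_op_inject[symmetric] apply_op_simps fun_eq_iff[of "Q_op n N k l"] Q_op_def)
  qed
  show "P_lin j k * P_lin j l = P_lin k l * P_lin j k" if "distinct [j, k, l]"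
    by (simp add: apply_op_inject[symmetric] apply_op_simps P_op_conj[OF that])
  show "P_lin j k * Q_lin n N j l = Q_lin n N k l * P_lin j k" 
    "Q_lin n N j k * Q_lin n N j l = Q_lin n N j k * P_lin k l"
    if "distinct [j, k, l]" "{j, k, l} \<subseteq> {1..n}"
    by (simp_all add: apply_op_inject[symmetric] apply_op_simps P_op_Q_op_conj[OF that] Q_op_Q_op[OF that])
  show "P_lin i j * P_lin k l = P_lin k l * P_lin i j" if "distinct [i, j, k, l]"
  proof -
    have "transpose i j \<circ> transpose k l = transpose k l \<circ> transpose i j"
      using that by (auto simp: transpose_def fun_eq_iff)
    then have "P_op i j (P_op k l x) = P_op k l (P_op i j x)" for x
      by (simp add: P_op_def comp_assoc)
    then show ?thesis
      by (simp add: apply_op_inject[symmetric] apply_op_simps)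
  qed
  show "Q_lin n N i j * P_lin k l = P_lin k l * Q_lin n N i j"
    "Q_lin n N i j * Q_lin n N k l = Q_lin n N k l * Q_lin n N i j"
    if "distinct [i, j, k, l]" "{i, j, k, l} \<subseteq> {1..n}"
    using Q_op_Q_op_commute[OF that] P_op_Q_op_commute[OF that]
    by (simp_all add: apply_op_inject[symmetric] apply_op_simps)
  assume kl: "k \<in> {1..n}" "l \<in> {1..n}" "k \<noteq> l"
  show "P_lin k l * P_lin k l = 1"
    by (simp add: apply_op_inject[symmetric] apply_op_simps P_op_def comp_assoc)
  have "a(k := i, l := i) \<circ> transpose k l = a(k := i, l := i)" for a :: "nat \<Rightarrow> nat" and i
    by (auto simp: transpose_def fun_eq_iff)
  then have "Q_op n N k l (P_op k l x) = Q_op n N k l x" for x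
    by (simp only: Q_op_def P_op_def)
  then show "Q_lin n N k l * P_lin k l = Q_lin n N k l"
    by (simp add: apply_op_inject[symmetric] apply_op_simps)
  have "P_op k l (Q_op n N k l x) a = Q_op n N k l x a" for x a
  proof -
    have "a \<circ> transpose k l = a" if "a k = a l"
      using that by (auto simp: transpose_def fun_eq_iff)
    then show ?thesis
      using kl multi_indices_transpose_iff[of k n l a N] by (auto simp: P_op_def Q_op_def transpose_def)
  qed
  then show "P_lin k l * Q_lin n N k l = Q_lin n N k l"
    by (simp add: apply_op_inject[symmetric] apply_op_simps fun_eq_iff)
qed

lemma apply_op_one_minus:
  "apply_op (1 - scale_op (inverse d) X) = one_minus_over (apply_op X) d"
  by (simp add: apply_op_simps one_minus_over_def fun_eq_iff divide_inverse mult.commute)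

lemma ordered_prod_conv_prod_list:
  "ordered_prod (\<lambda>k l. apply_op (F k l)) ps = apply_op (\<Prod>(k, l)\<leftarrow>ps. F k l)"
  by (induction ps) (auto simp: ordered_prod_def apply_op_simps o_def id_def)

lemma pair_prod_upt:
  assumes "m \<le> Suc n"
  shows "pair_prod F [m..<Suc n] = (\<Prod>(k, l)\<leftarrow>[(k, l). k \<leftarrow> [m..<Suc n], l \<leftarrow> [Suc k..<Suc n]]. F k l)"
    "rev_pair_prod F [m..<Suc n] = (\<Prod>(k, l)\<leftarrow>rev [(k, l). k \<leftarrow> [m..<Suc n], l \<leftarrow> [Suc k..<Suc n]]. F k l)"
  using assms
proof (induction m rule: inc_induct)
  case (step m)
  have "[m..<Suc n] = m # [Suc m..<Suc n]"
    using step.hyps by (simp add: upt_conv_Cons del: upt_Suc)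
  then show "pair_prod F [m..<Suc n] = (\<Prod>(k, l)\<leftarrow>[(k, l). k \<leftarrow> [m..<Suc n], l \<leftarrow> [Suc k..<Suc n]]. F k l)"
    "rev_pair_prod F [m..<Suc n] = (\<Prod>(k, l)\<leftarrow>rev [(k, l). k \<leftarrow> [m..<Suc n], l \<leftarrow> [Suc k..<Suc n]]. F k l)"
    using step.IH by (simp_all add: o_def rev_map del: upt_Suc)
qed simp_all

lemma ordered_prod_lex_pairs:
  "ordered_prod (\<lambda>k l. apply_op (F k l)) (lex_pairs n) = apply_op (pair_prod F [1..<Suc n])"
  "ordered_prod (\<lambda>k l. apply_op (F k l)) (rev (lex_pairs n)) = apply_op (rev_pair_prod F [1..<Suc n])"
  unfolding ordered_prod_conv_prod_list lex_pairs_def by (subst pair_prod_upt; simp)+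

lemma ordered_prod_filter:
  "ordered_prod F (filter (\<lambda>(k, l). p k l) ps) = ordered_prod (\<lambda>k l. if p k l then F k l else id) ps"
  by (induction ps) (auto simp: ordered_prod_def)

section \<open>Columns of the column tableau\<close>

definition col :: "(nat \<times> nat) set \<Rightarrow> nat \<Rightarrow> nat" where
  "col \<omega> k = snd (box_of \<omega> k)"

definition row :: "(nat \<times> nat) set \<Rightarrow> nat \<Rightarrow> nat" where
  "row \<omega> k = fst (box_of \<omega> k)"

lemma content_eq: "content \<omega> k = int (col \<omega> k) - int (row \<omega> k)"
  by (simp add: content_def col_def row_def)

lemma same_column_eq: "same_column \<omega> k l \<longleftrightarrow> col \<omega> k = col \<omega> l"
  by (simp add: same_column_def col_def)

text \<open>The order in which the column tableau numbers the boxes.\<close>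

definition precedes :: "nat \<times> nat \<Rightarrow> nat \<times> nat \<Rightarrow> bool" where
  "precedes b b' \<longleftrightarrow> snd b < snd b' \<or> (snd b = snd b' \<and> fst b < fst b')"

lemma column_tableau_less:
  assumes "finite \<omega>" "b' \<in> \<omega>" "precedes b b'"
  shows "column_tableau \<omega> b < column_tableau \<omega> b'"
proof -
  have "{(i, j) \<in> \<omega>. j < snd b \<or> j = snd b \<and> i \<le> fst b} \<subset>
      {(i, j) \<in> \<omega>. j < snd b' \<or> j = snd b' \<and> i \<le> fst b'}" (is "?X \<subset> ?Y")
  proof (rule psubsetI)
    show "?X \<subseteq> ?Y"
      using assms(3) by (auto simp: precedes_def)
    have "b' \<in> ?Y" "b' \<notin> ?X"
      using assms(2,3) by (auto simp: precedes_def split_beta)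
    then show "?X \<noteq> ?Y" by blast
  qed
  moreover have "finite ?Y"
    using assms(1) by (rule rev_finite_subset) auto
  ultimately show ?thesis
    unfolding column_tableau_def split_beta by (auto intro: psubset_card_mono)
qed

lemma bij_betw_column_tableau:
  assumes "finite \<omega>"
  shows "bij_betw (column_tableau \<omega>) \<omega> {1..card \<omega>}"
proof -
  have inj: "inj_on (column_tableau \<omega>) \<omega>"
  proof (rule inj_onI)
    fix b b' assume b: "b \<in> \<omega>" "b' \<in> \<omega>" "column_tableau \<omega> b = column_tableau \<omega> b'"
    then have "\<not> precedes b b'" "\<not> precedes b' b"
      using column_tableau_less[OF assms] by fastforce+
    then show "b = b'"
      by (auto simp: precedes_def prod_eq_iff)
  qed
  have "column_tableau \<omega> b \<in> {1..card \<omega>}" if "b \<in> \<omega>" for b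
  proof -
    have "{(i, j) \<in> \<omega>. j < snd b \<or> j = snd b \<and> i \<le> fst b} \<subseteq> \<omega>" (is "?X \<subseteq> _")
      by auto
    moreover have "b \<in> ?X"
      using that by (simp add: split_beta)
    ultimately have "card ?X \<le> card \<omega>" "0 < card ?X"
      using assms by (auto intro: card_mono simp: card_gt_0_iff finite_subset)
    then show ?thesis
      by (auto simp: column_tableau_def split_beta)
  qed
  then have "column_tableau \<omega> ` \<omega> = {1..card \<omega>}"
    using inj by (intro card_subset_eq) (auto simp: card_image)
  then show ?thesis
    using inj by (simp add: bij_betw_def)
qed

lemma box_of_column_tableau:
  assumes "finite \<omega>" "b \<in> \<omega>"
  shows "box_of \<omega> (column_tableau \<omega> b) = b"
  unfolding box_of_def using bij_betw_column_tableau[OF assms(1)] assms(2)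
  by (intro the_inv_into_f_f) (auto simp: bij_betw_def)

lemma box_of:
  assumes "finite \<omega>" "k \<in> {1..card \<omega>}"
  shows "box_of \<omega> k \<in> \<omega>" "column_tableau \<omega> (box_of \<omega> k) = k"
  using bij_betw_column_tableau[OF assms(1)] assms(2) unfolding box_of_def
  by (auto simp: bij_betw_def intro: the_inv_into_into f_the_inv_into_f)

lemma box_row_col: "box_of \<omega> k = (row \<omega> k, col \<omega> k)"
  by (simp add: row_def col_def)

lemma row_col_less:
  assumes "finite \<omega>" "k \<in> {1..card \<omega>}" "l \<in> {1..card \<omega>}" "k < l"
  shows "col \<omega> k < col \<omega> l \<or> (col \<omega> k = col \<omega> l \<and> row \<omega> k < row \<omega> l)"
proof (rule ccontr)
  assume "\<not> ?thesis"
  then have "precedes (box_of \<omega> l) (box_of \<omega> k) \<or> box_of \<omega> l = box_of \<omega> k"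
    by (auto simp: precedes_def box_row_col)
  then show False
    using column_tableau_less[OF assms(1), of "box_of \<omega> k" "box_of \<omega> l"]
      box_of[OF assms(1,2)] box_of[OF assms(1,3)] \<open>k < l\<close> by auto
qed

lemma entry_exists:
  assumes "finite \<omega>" "(i, j) \<in> \<omega>"
  obtains k where "k \<in> {1..card \<omega>}" "row \<omega> k = i" "col \<omega> k = j"
  using bij_betwE[OF bij_betw_column_tableau[OF assms(1)]] box_of_column_tableau[OF assms] assms(2)
  unfolding row_def col_def by force

text \<open>Every column up to the last one is listed, including empty ones, so that the position in the list is the
column index.\<close>

definition columns :: "(nat \<times> nat) set \<Rightarrow> nat list list" where
  "columns \<omega> = map (\<lambda>j. filter (\<lambda>k. col \<omega> k = j) [1..<Suc (card \<omega>)])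
     [0..<Suc (Max (insert 0 (snd ` \<omega>)))]"

lemma filter_append_sorted:
  assumes "sorted (map c xs)"
  shows "filter (\<lambda>x. c x < m) xs @ filter (\<lambda>x. \<not> c x < (m::nat)) xs = xs"
  using assms
proof (induction xs)
  case (Cons x xs)
  show ?case
  proof (cases "c x < m")
    case False
    then have "\<forall>y\<in>set xs. \<not> c y < m"
      using Cons.prems by force
    then have "filter (\<lambda>x. c x < m) xs = []" "filter (\<lambda>x. \<not> c x < m) xs = xs"
      by (auto simp: filter_empty_conv filter_id_conv)
    then show ?thesis
      using False by simp
  qed (use Cons in simp)
qed simp

text \<open>A list on which the nonnegative integer \<open>c\<close> increases weakly is the concatenation of the level sets of \<open>c\<close>.\<close>

lemma concat_levels:
  assumes "sorted (map c xs)" "\<forall>x\<in>set xs. c x < (m::nat)"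
  shows "concat (map (\<lambda>j. filter (\<lambda>x. c x = j) xs) [0..<m]) = xs"
  using assms
proof (induction m arbitrary: xs)
  case 0
  then show ?case by (cases xs) auto
next
  case (Suc m)
  let ?ys = "filter (\<lambda>x. c x < m) xs"
  have "concat (map (\<lambda>j. filter (\<lambda>x. c x = j) ?ys) [0..<m]) = ?ys"
    using Suc.prems(1) by (intro Suc.IH) (auto simp: sorted_filter)
  also have "map (\<lambda>j. filter (\<lambda>x. c x = j) ?ys) [0..<m] = map (\<lambda>j. filter (\<lambda>x. c x = j) xs) [0..<m]"
    by (auto intro!: filter_cong)
  finally have "concat (map (\<lambda>j. filter (\<lambda>x. c x = j) xs) [0..<Suc m]) =
      ?ys @ filter (\<lambda>x. c x = m) xs"
    by simp
  also have "filter (\<lambda>x. c x = m) xs = filter (\<lambda>x. \<not> c x < m) xs"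
    using Suc.prems(2) by (intro filter_cong) auto
  finally show ?case
    using filter_append_sorted[OF Suc.prems(1)] by simp
qed

lemma concat_columns:
  assumes "finite \<omega>"
  shows "concat (columns \<omega>) = [1..<Suc (card \<omega>)]"
  unfolding columns_def
proof (rule concat_levels)
  have "col \<omega> k \<le> col \<omega> l" if "k \<in> {1..card \<omega>}" "l \<in> {1..card \<omega>}" "k \<le> l" for k l
    using row_col_less[OF assms that(1,2)] that(3) by (cases "k = l") auto
  then show "sorted (map (col \<omega>) [1..<Suc (card \<omega>)])"
    by (auto simp: sorted_iff_nth_mono simp del: upt_Suc)
  show "\<forall>k\<in>set [1..<Suc (card \<omega>)]. col \<omega> k < Suc (Max (insert 0 (snd ` \<omega>)))"
    using box_of(1)[OF assms] assms by (auto simp: col_def less_Suc_eq_le intro!: Max_ge simp del: upt_Suc)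
qed

lemma set_columns:
  assumes "C \<in> set (columns \<omega>)" "k \<in> set C"
  shows "set C = {l \<in> {1..card \<omega>}. col \<omega> l = col \<omega> k}" "k \<in> {1..card \<omega>}"
    and "sorted_wrt (<) C"
  using assms by (auto simp: columns_def simp del: upt_Suc intro: sorted_wrt_filter)

subsection \<open>Contents in a skew diagram\<close>

lemma finite_skew_diagram:
  assumes "is_partition lam"
  shows "finite (skew_diagram lam mu)"
proof (rule finite_subset)
  show "skew_diagram lam mu \<subseteq> (SIGMA i:{i. 1 \<le> i \<and> lam i \<noteq> 0}. {1..lam i})"
    by (auto simp: skew_diagram_def)
  show "finite (SIGMA i:{i. 1 \<le> i \<and> lam i \<noteq> 0}. {1..lam i})"
    using assms by (auto simp: is_partition_def)
qed

lemma partition_antimono: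
  assumes "is_partition lam" "1 \<le> i" "i \<le> i'"
  shows "lam i' \<le> lam i"
  using assms(3)
proof (induction rule: dec_induct)
  case (step m)
  then show ?case
    using assms(1,2) by (auto simp: is_partition_def intro: order_trans)
qed simp

lemma conjugate_antimono:
  assumes "is_partition lam" "1 \<le> j" "j \<le> j'"
  shows "conjugate lam j' \<le> conjugate lam j"
  unfolding conjugate_def
proof (rule card_mono)
  show "finite {i. 1 \<le> i \<and> j \<le> lam i}"
    using assms(1,2) by (auto simp: is_partition_def elim: rev_finite_subset)
qed (use assms in auto)

lemma row_le_conjugate:
  assumes "is_partition lam" "1 \<le> i" "1 \<le> j" "j \<le> lam i"
  shows "i \<le> conjugate lam j"
proof -
  have "{1..i} \<subseteq> {i. 1 \<le> i \<and> j \<le> lam i}"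
    using partition_antimono[OF assms(1), of _ i] assms(4) by (auto intro: order_trans)
  moreover have "finite {i. 1 \<le> i \<and> j \<le> lam i}"
    using assms(1,3) by (auto simp: is_partition_def elim: rev_finite_subset)
  ultimately have "card {1..i} \<le> conjugate lam j"
    unfolding conjugate_def by (intro card_mono)
  then show ?thesis
    by simp
qed

locale skew_shape =
  fixes lam mu :: "nat \<Rightarrow> nat" and \<omega> :: "(nat \<times> nat) set" and n :: nat
  assumes lam: "is_partition lam" and mu: "is_partition mu"
    and \<omega>: "\<omega> = skew_diagram lam mu" and n: "n = card \<omega>"
begin

lemma finite_\<omega>: "finite \<omega>"
  unfolding \<omega> using lam by (rule finite_skew_diagram)

lemma mem_shape_iff: "(i, j) \<in> \<omega> \<longleftrightarrow> 1 \<le> i \<and> mu i < j \<and> j \<le> lam i"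
  by (simp add: \<omega> skew_diagram_def)

lemma box_in_shape:
  assumes "k \<in> {1..n}"
  shows "1 \<le> row \<omega> k" "mu (row \<omega> k) < col \<omega> k" "col \<omega> k \<le> lam (row \<omega> k)"
proof -
  have "(row \<omega> k, col \<omega> k) \<in> \<omega>"
    using box_of(1)[OF finite_\<omega>, of k] assms unfolding box_row_col n by blast
  then show "1 \<le> row \<omega> k" "mu (row \<omega> k) < col \<omega> k" "col \<omega> k \<le> lam (row \<omega> k)"
    by (simp_all add: mem_shape_iff)
qed

text \<open>A box between two boxes of a column belongs to the skew diagram because \<open>\<lambda>\<close> and \<open>\<mu>\<close> are decreasing, so its
entry would lie between two neighbouring entries.\<close>

lemma column_rows_consecutive:
  assumes "C \<in> set (columns \<omega>)"
  shows "successively (\<lambda>k l. row \<omega> l = Suc (row \<omega> k)) C"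
  unfolding successively_conv_nth
proof (intro allI impI)
  fix p assume p: "Suc p < length C"
  let ?k = "C ! p" and ?l = "C ! Suc p"
  have kC: "?k \<in> set C" "?l \<in> set C"
    using p by auto
  note C = set_columns[OF assms kC(1)]
  have k: "?k \<in> {1..n}" "?l \<in> {1..n}" "col \<omega> ?l = col \<omega> ?k"
    using kC unfolding C(1) n by auto
  have "?k < ?l"
    using C(3) p by (simp add: sorted_wrt_iff_nth_less)
  then have less: "row \<omega> ?k < row \<omega> ?l"
    using row_col_less[OF finite_\<omega>, of ?k ?l] k n by auto
  show "row \<omega> ?l = Suc (row \<omega> ?k)"
  proof (rule ccontr)
    assume "row \<omega> ?l \<noteq> Suc (row \<omega> ?k)"
    with less have gap: "Suc (row \<omega> ?k) < row \<omega> ?l"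
      by simp
    have "mu (Suc (row \<omega> ?k)) \<le> mu (row \<omega> ?k)" "lam (row \<omega> ?l) \<le> lam (Suc (row \<omega> ?k))"
      using box_in_shape[OF k(1)] gap by (auto intro: partition_antimono lam mu)
    then have "(Suc (row \<omega> ?k), col \<omega> ?k) \<in> \<omega>"
      using box_in_shape[OF k(1)] box_in_shape[OF k(2)] k(3) by (simp add: mem_shape_iff)
    then obtain m where m: "m \<in> {1..card \<omega>}" "row \<omega> m = Suc (row \<omega> ?k)" "col \<omega> m = col \<omega> ?k"
      by (rule entry_exists[OF finite_\<omega>])
    have "m \<in> set C"
      using m unfolding C(1) by simp
    then obtain q where q: "q < length C" "m = C ! q"
      by (auto simp: in_set_conv_nth)
    have "?k < m"
      using row_col_less[OF finite_\<omega>, of m ?k] m k n by (cases m ?k rule: linorder_cases) auto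
    moreover have "m < ?l"
      using row_col_less[OF finite_\<omega>, of ?l m] m k n gap by (cases m ?l rule: linorder_cases) auto
    moreover have "i < j" if "C ! i < C ! j" "i < length C" "j < length C" for i j
      using that C(3) by (cases i j rule: linorder_cases) (force simp: sorted_wrt_iff_nth_less)+
    ultimately have "p < q" "q < Suc p"
      using p q by auto
    then show False
      by simp
  qed
qed

text \<open>If an earlier box lay on the diagonal of the top box of a later column, it would lie strictly above that box's
row, so the box above the top one would be within \<open>\<lambda>\<close>. Not belonging to \<open>\<omega>\<close>, it would lie in \<open>\<mu>\<close>, and then \<open>\<mu>\<close>
would also contain the earlier box.\<close>

lemma content_ne_top_of_later_column:
  assumes C: "C \<in> set (columns \<omega>)" "l \<in> set C"
    and k: "k \<in> {1..n}" "col \<omega> k < col \<omega> l"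
  shows "content \<omega> k \<noteq> content \<omega> (hd C)"
proof
  assume eq: "content \<omega> k = content \<omega> (hd C)"
  let ?l = "hd C"
  have hd: "?l \<in> set C"
    using C(2) by (cases C) auto
  note set_C = set_columns[OF C(1) hd]
  have l: "?l \<in> {1..n}" "col \<omega> ?l = col \<omega> l"
    using hd set_columns(1)[OF C] unfolding n by auto
  have "int (row \<omega> ?l) = int (row \<omega> k) + (int (col \<omega> ?l) - int (col \<omega> k))"
    using eq by (simp add: content_eq)
  then have rows: "row \<omega> k < row \<omega> ?l"
    using k(2) l(2) by linarith
  define i where "i = row \<omega> ?l - 1"
  have i: "row \<omega> k \<le> i" "1 \<le> i" "row \<omega> ?l = Suc i"
    using rows box_in_shape(1)[OF k(1)] by (auto simp: i_def)
  have "(i, col \<omega> ?l) \<notin> \<omega>"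
  proof
    assume "(i, col \<omega> ?l) \<in> \<omega>"
    then obtain m where m: "m \<in> {1..card \<omega>}" "row \<omega> m = i" "col \<omega> m = col \<omega> ?l"
      by (rule entry_exists[OF finite_\<omega>])
    have "m \<in> set C"
      using m unfolding set_C(1) by simp
    then have "?l \<le> m"
      using set_C(3) by (cases C) auto
    moreover have "?l \<noteq> m"
      using m(2) i(3) by auto
    ultimately have "?l < m"
      by simp
    from row_col_less[OF finite_\<omega> l(1)[unfolded n] m(1) this] show False
      using m(2,3) i(3) by simp
  qed
  moreover have "col \<omega> ?l \<le> lam i"
    using partition_antimono[OF lam i(2), of "row \<omega> ?l"] box_in_shape(3)[OF l(1)] i by simp
  ultimately have "col \<omega> ?l \<le> mu i"
    using i(2) by (simp add: mem_shape_iff)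
  also have "\<dots> \<le> mu (row \<omega> k)"
    using partition_antimono[OF mu box_in_shape(1)[OF k(1)] i(1)] .
  also have "\<dots> < col \<omega> k"
    by (rule box_in_shape(2)[OF k(1)])
  finally show False
    using k(2) l(2) by simp
qed

text \<open>The rows of the two boxes are at most \<open>\<lambda>'\<^sub>1\<close> and \<open>\<lambda>'\<^sub>2\<close>, and their column indices add up to at least 3.\<close>

lemma content_sum_bound:
  assumes "conjugate lam 1 + conjugate lam 2 \<le> K"
    and k: "k \<in> {1..n}" "l \<in> {1..n}" "col \<omega> k \<noteq> col \<omega> l"
  shows "0 < content \<omega> k + content \<omega> l + int K - 1"
proof -
  have *: "0 < content \<omega> k + content \<omega> l + int K - 1"
    if k: "k \<in> {1..n}" "l \<in> {1..n}" and less: "col \<omega> k < col \<omega> l" for k l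
  proof -
    have ck: "1 \<le> col \<omega> k"
      using box_in_shape(2)[OF k(1)] by simp
    have "row \<omega> k \<le> conjugate lam (col \<omega> k)" "row \<omega> l \<le> conjugate lam (col \<omega> l)"
      using box_in_shape[OF k(1)] box_in_shape[OF k(2)] by (auto intro!: row_le_conjugate lam)
    moreover have "conjugate lam (col \<omega> k) \<le> conjugate lam 1"
      using ck by (intro conjugate_antimono lam) auto
    moreover have "conjugate lam (col \<omega> l) \<le> conjugate lam 2"
      using ck less by (intro conjugate_antimono lam) auto
    ultimately show ?thesis
      using assms(1) ck less by (simp add: content_eq)
  qed
  show ?thesis
  proof (cases "col \<omega> k < col \<omega> l")
    case True
    with k show ?thesis by (intro *)
  next
    case False
    with k have "0 < content \<omega> l + content \<omega> k + int K - 1" by (intro *) simp_all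
    then show ?thesis by linarith
  qed
qed

end

section \<open>Regular values of rational functions and operators\<close>

text \<open>The point \<open>t0\<close> is added to the domain because the function is a given expression which is meaningful at \<open>t0\<close>
too, and its regular value is then the value of this expression.\<close>

definition regular_at :: "nat \<Rightarrow> (nat \<Rightarrow> complex) set \<Rightarrow> (nat \<Rightarrow> complex) \<Rightarrow> ((nat \<Rightarrow> complex) \<Rightarrow> complex) \<Rightarrow> bool" where
  "regular_at n D t0 f \<longleftrightarrow> has_regular_value n (insert t0 D) f t0 (f t0)"

lemma regular_at_iff:
  "regular_at n D t0 f \<longleftrightarrow> (\<exists>p q. polynomial_fun n p \<and> polynomial_fun n q \<and> q t0 \<noteq> 0 \<and>
     (\<forall>t\<in>insert t0 D. q t * f t = p t))"
  unfolding regular_at_def has_regular_value_def by (fastforce simp: field_simps)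

lemma has_regular_value_cong:
  assumes "regular_at n D t0 f" "\<And>t. t \<in> D' \<Longrightarrow> f t = g t" "D' \<subseteq> D"
  shows "has_regular_value n D' g t0 (f t0)"
  using assms unfolding regular_at_def has_regular_value_def by (metis insert_iff subset_iff)

lemma regular_at_const: "regular_at n D t0 (\<lambda>t. c)"
  unfolding regular_at_iff
  by (intro exI[of _ "\<lambda>t. c"] exI[of _ "\<lambda>t. 1"]) (auto intro: polynomial_fun.const)

lemma regular_at_add:
  assumes "regular_at n D t0 f" "regular_at n D t0 g"
  shows "regular_at n D t0 (\<lambda>t. f t + g t)"
proof -
  obtain p q p' q' where p: "polynomial_fun n p" "polynomial_fun n q" "q t0 \<noteq> 0"
      "\<And>t. t \<in> insert t0 D \<Longrightarrow> p t = q t * f t"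
    and p': "polynomial_fun n p'" "polynomial_fun n q'" "q' t0 \<noteq> 0"
      "\<And>t. t \<in> insert t0 D \<Longrightarrow> p' t = q' t * g t"
    using assms unfolding regular_at_iff by metis
  have "polynomial_fun n (\<lambda>t. p t * q' t + p' t * q t)" "polynomial_fun n (\<lambda>t. q t * q' t)" "q t0 * q' t0 \<noteq> 0"
    using p p' by (auto intro!: polynomial_fun.intros)
  moreover have "\<forall>t\<in>insert t0 D. (q t * q' t) * (f t + g t) = p t * q' t + p' t * q t"
    by (intro ballI) (simp only: p(4) p'(4) algebra_simps)
  ultimately show ?thesis
    unfolding regular_at_iff by blast
qed

lemma regular_at_mult:
  assumes "regular_at n D t0 f" "regular_at n D t0 g"
  shows "regular_at n D t0 (\<lambda>t. f t * g t)"
proof -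
  obtain p q p' q' where p: "polynomial_fun n p" "polynomial_fun n q" "q t0 \<noteq> 0"
      "\<And>t. t \<in> insert t0 D \<Longrightarrow> p t = q t * f t"
    and p': "polynomial_fun n p'" "polynomial_fun n q'" "q' t0 \<noteq> 0"
      "\<And>t. t \<in> insert t0 D \<Longrightarrow> p' t = q' t * g t"
    using assms unfolding regular_at_iff by metis
  have "polynomial_fun n (\<lambda>t. p t * p' t)" "polynomial_fun n (\<lambda>t. q t * q' t)" "q t0 * q' t0 \<noteq> 0"
    using p p' by (auto intro!: polynomial_fun.intros)
  moreover have "\<forall>t\<in>insert t0 D. (q t * q' t) * (f t * g t) = p t * p' t"
    by (intro ballI) (simp only: p(4) p'(4) algebra_simps)
  ultimately show ?thesis
    unfolding regular_at_iff by blast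
qed

lemma regular_at_diff:
  assumes "regular_at n D t0 f" "regular_at n D t0 g"
  shows "regular_at n D t0 (\<lambda>t. f t - g t)"
  using regular_at_add[OF assms(1) regular_at_mult[OF regular_at_const[of n D t0 "-1"] assms(2)]]
  by simp

lemma regular_at_sum:
  assumes "finite A" "\<And>i. i \<in> A \<Longrightarrow> regular_at n D t0 (f i)"
  shows "regular_at n D t0 (\<lambda>t. \<Sum>i\<in>A. f i t)"
  using assms by (induction A rule: finite_induct) (auto intro: regular_at_const regular_at_add)

lemma regular_at_inverse:
  assumes "polynomial_fun n d" "\<And>t. t \<in> insert t0 D \<Longrightarrow> d t \<noteq> 0"
  shows "regular_at n D t0 (\<lambda>t. inverse (d t))"
  unfolding regular_at_iff
  using assms by (intro exI[of _ "\<lambda>t. 1"] exI[of _ d]) (auto intro: polynomial_fun.const)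

lemma continuous_on_polynomial_fun_line:
  fixes t0 v :: "nat \<Rightarrow> complex"
  assumes "polynomial_fun n p"
  shows "continuous_on UNIV (\<lambda>s::complex. p (\<lambda>k. t0 k + s * v k))"
  using assms by induction (auto intro!: continuous_intros)

text \<open>Two representations give polynomials \<open>p q'\<close> and \<open>p' q\<close> that agree on the domain, hence by continuity along the
line also at \<open>t0\<close>.\<close>

lemma has_regular_value_unique:
  assumes "has_regular_value n D f t0 v" "has_regular_value n D f t0 v'"
    and line: "\<forall>\<^sub>F s in at (0::complex). (\<lambda>k. t0 k + s * d k) \<in> D"
  shows "v = v'"
proof -
  obtain p q p' q' where p: "polynomial_fun n p" "polynomial_fun n q" "q t0 \<noteq> 0"
      "\<forall>t\<in>D. q t * f t = p t" "v = p t0 / q t0"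
    and p': "polynomial_fun n p'" "polynomial_fun n q'" "q' t0 \<noteq> 0"
      "\<forall>t\<in>D. q' t * f t = p' t" "v' = p' t0 / q' t0"
    using assms(1,2) unfolding has_regular_value_def by metis
  define w where "w = (\<lambda>t. p t * q' t + (-1) * (p' t * q t))"
  have "polynomial_fun n w"
    unfolding w_def using p p' by (intro polynomial_fun.intros)
  from continuous_on_polynomial_fun_line[OF this, of t0 d]
  have lim: "((\<lambda>s. w (\<lambda>k. t0 k + s * d k)) \<longlongrightarrow> w (\<lambda>k. t0 k + 0 * d k)) (at 0)"
    unfolding continuous_on_def by (rule bspec) simp
  have "\<forall>\<^sub>F s in at 0. w (\<lambda>k. t0 k + s * d k) = 0"
    using line
  proof eventually_elim
    case (elim s)
    then show ?case
      using p(4) p'(4) unfolding w_def by (simp add: algebra_simps flip: p(4) p'(4))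
  qed
  then have "((\<lambda>s. w (\<lambda>k. t0 k + s * d k)) \<longlongrightarrow> 0) (at 0)"
    by (rule tendsto_eventually)
  from tendsto_unique[OF at_neq_bot lim this] have "w t0 = 0"
    by simp
  then have "p t0 * q' t0 = p' t0 * q t0"
    by (simp add: w_def)
  then show ?thesis
    unfolding p(5) p'(5) using p(3) p'(3) by (simp add: frac_eq_eq)
qed

lemma eventually_affine_nonzero:
  fixes a b :: complex
  assumes "a \<noteq> 0 \<or> b \<noteq> 0"
  shows "\<forall>\<^sub>F s in at 0. a + s * b \<noteq> 0"
proof (cases "a = 0")
  case True
  then show ?thesis
    using assms by (auto simp: eventually_at_filter)
next
  case False
  have "((\<lambda>s. a + s * b) \<longlongrightarrow> a + 0 * b) (at 0)"
    by (intro tendsto_intros)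
  then show ?thesis
    using False by (intro tendsto_imp_eventually_ne[of _ a]) simp_all
qed

text \<open>Applying the operators to families of tensors that vary regularly with \<open>t\<close>, rather than to fixed tensors,
makes closure under composition immediate.\<close>

definition regular_family ::
    "nat \<Rightarrow> (nat \<Rightarrow> complex) set \<Rightarrow> (nat \<Rightarrow> complex) \<Rightarrow> ((nat \<Rightarrow> complex) \<Rightarrow> 'i operator) \<Rightarrow> bool" where
  "regular_family n D t0 F \<longleftrightarrow>
     (\<forall>x. (\<forall>a. regular_at n D t0 (\<lambda>t. x t a)) \<longrightarrow> (\<forall>a. regular_at n D t0 (\<lambda>t. apply_op (F t) (x t) a)))"

lemma regular_familyD:
  assumes "regular_family n D t0 F"
  shows "regular_at n D t0 (\<lambda>t. apply_op (F t) x a)"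
  using assms regular_at_const unfolding regular_family_def by fastforce

lemma regular_family_one: "regular_family n D t0 (\<lambda>t. 1)"
  by (simp add: regular_family_def apply_op_simps)

lemma regular_family_zero: "regular_family n D t0 (\<lambda>t. 0)"
  by (simp add: regular_family_def apply_op_simps regular_at_const)

lemma regular_family_mult:
  assumes "regular_family n D t0 F" "regular_family n D t0 G"
  shows "regular_family n D t0 (\<lambda>t. F t * G t)"
  using assms by (simp add: regular_family_def apply_op_simps)

lemma regular_family_diff:
  assumes "regular_family n D t0 F" "regular_family n D t0 G"
  shows "regular_family n D t0 (\<lambda>t. F t - G t)"
  using assms by (simp add: regular_family_def apply_op_simps regular_at_diff)

lemma regular_family_add:
  assumes "regular_family n D t0 F" "regular_family n D t0 G"
  shows "regular_family n D t0 (\<lambda>t. F t + G t)"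
  using assms by (simp add: regular_family_def apply_op_simps regular_at_add)

lemma regular_family_scale:
  assumes "regular_at n D t0 c" "regular_family n D t0 F"
  shows "regular_family n D t0 (\<lambda>t. scale_op (c t) (F t))"
  using assms by (simp add: regular_family_def apply_op_simps regular_at_mult)

lemma regular_family_P_lin: "regular_family n D t0 (\<lambda>t. P_lin k l)"
  by (simp add: regular_family_def apply_op_simps P_op_def)

lemma regular_family_Q_lin: "regular_family n D t0 (\<lambda>t. Q_lin m N k l)"
  unfolding regular_family_def apply_op_simps Q_op_def
proof (intro allI impI)
  fix x :: "(nat \<Rightarrow> complex) \<Rightarrow> tensor" and a
  assume "\<forall>a. regular_at n D t0 (\<lambda>t. x t a)"
  then show "regular_at n D t0 (\<lambda>t. if a \<in> multi_indices m N \<and> a k = a l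
      then \<Sum>i = 1..N. x t (a(k := i, l := i)) else 0)"
    by (cases "a \<in> multi_indices m N \<and> a k = a l")
      (simp_all only: if_True if_False simp_thms, simp_all add: regular_at_sum regular_at_const)
qed

lemma regular_family_sum_list:
  assumes "\<And>y. y \<in> set ys \<Longrightarrow> regular_family n D t0 (F y)"
  shows "regular_family n D t0 (\<lambda>t. \<Sum>y\<leftarrow>ys. F y t)"
  using assms by (induction ys) (auto intro: regular_family_zero regular_family_add)

lemma regular_family_prod_list:
  assumes "\<And>y. y \<in> set ys \<Longrightarrow> regular_family n D t0 (F y)"
  shows "regular_family n D t0 (\<lambda>t. \<Prod>y\<leftarrow>ys. F y t)"
  using assms by (induction ys) (auto intro: regular_family_one regular_family_mult)

lemma regular_family_pair_prod:
  assumes "distinct xs"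
    and "\<And>k l. k \<in> set xs \<Longrightarrow> l \<in> set xs \<Longrightarrow> k \<noteq> l \<Longrightarrow> regular_family n D t0 (\<lambda>t. F t k l)"
  shows "regular_family n D t0 (\<lambda>t. pair_prod (F t) xs)" "regular_family n D t0 (\<lambda>t. rev_pair_prod (F t) xs)"
proof -
  show "regular_family n D t0 (\<lambda>t. pair_prod (F t) xs)"
    using assms
  proof (induction xs)
    case (Cons x xs)
    have "regular_family n D t0 (\<lambda>t. \<Prod>y\<leftarrow>xs. F t x y)"
      using Cons.prems by (intro regular_family_prod_list) auto
    with Cons show ?case by (simp add: regular_family_mult)
  qed (simp add: regular_family_one)
  show "regular_family n D t0 (\<lambda>t. rev_pair_prod (F t) xs)"
    using assms
  proof (induction xs)
    case (Cons x xs)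
    have "regular_family n D t0 (\<lambda>t. \<Prod>y\<leftarrow>rev xs. F t x y)"
      using Cons.prems by (intro regular_family_prod_list) auto
    with Cons show ?case by (simp add: regular_family_mult)
  qed (simp add: regular_family_one)
qed

section \<open>Adjoint operators\<close>

text \<open>The bilinear form on the tensor power induced by the one on \<open>\<complex>\<^sup>N\<close>.\<close>

definition pairing :: "nat \<Rightarrow> nat \<Rightarrow> tensor \<Rightarrow> tensor \<Rightarrow> complex" where
  "pairing n N x y = (\<Sum>a\<in>multi_indices n N. x a * y a)"

lemma finite_multi_indices: "finite (multi_indices n N)"
  unfolding multi_indices_def by (intro finite_PiE) auto

lemma pairing_nondegenerate:
  assumes "x \<in> tensors n N" "y \<in> tensors n N"
    and "\<And>z. z \<in> tensors n N \<Longrightarrow> pairing n N z x = pairing n N z y"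
  shows "x = y"
proof
  fix a
  show "x a = y a"
  proof (cases "a \<in> multi_indices n N")
    case True
    let ?z = "\<lambda>b. if b = a then 1 else 0"
    have "pairing n N ?z x = pairing n N ?z y"
      using True by (intro assms) (auto simp: tensors_def)
    then show ?thesis
      using True finite_multi_indices by (simp add: pairing_def if_distrib[of "\<lambda>c. c * _"] cong: if_cong)
  qed (use assms in \<open>auto simp: tensors_def\<close>)
qed

text \<open>The relation is stated for pairs of operators, so no adjoint has to be constructed: the reversed product is
exhibited as an adjoint.\<close>

definition adjoint_pair :: "nat \<Rightarrow> nat \<Rightarrow> (nat \<Rightarrow> nat) operator \<Rightarrow> (nat \<Rightarrow> nat) operator \<Rightarrow> bool" where
  "adjoint_pair n N F G \<longleftrightarrow>
     (\<forall>x\<in>tensors n N. apply_op F x \<in> tensors n N \<and> apply_op G x \<in> tensors n N) \<and>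
     (\<forall>x\<in>tensors n N. \<forall>y\<in>tensors n N. pairing n N (apply_op F x) y = pairing n N x (apply_op G y))"

lemma adjoint_pair_one: "adjoint_pair n N 1 1"
  by (simp add: adjoint_pair_def apply_op_simps)

lemma adjoint_pair_mult:
  assumes "adjoint_pair n N F F'" "adjoint_pair n N G G'"
  shows "adjoint_pair n N (F * G) (G' * F')"
  using assms by (simp add: adjoint_pair_def apply_op_simps)

lemma adjoint_pair_one_minus_scale:
  assumes "adjoint_pair n N F G"
  shows "adjoint_pair n N (1 - scale_op c F) (1 - scale_op c G)"
proof -
  have "pairing n N (\<lambda>a. x a - c * x' a) y = pairing n N x y - c * pairing n N x' y"
    "pairing n N x (\<lambda>a. y a - c * y' a) = pairing n N x y - c * pairing n N x y'" for x x' y y'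
    by (simp_all add: pairing_def algebra_simps sum_subtractf sum_distrib_left)
  then show ?thesis
    using assms by (simp add: adjoint_pair_def apply_op_simps) (simp add: tensors_def)
qed

lemma adjoint_pair_P_lin:
  assumes "k \<in> {1..n}" "l \<in> {1..n}"
  shows "adjoint_pair n N (P_lin k l) (P_lin k l)"
proof -
  have bij: "bij_betw (\<lambda>a. a \<circ> transpose k l) (multi_indices n N) (multi_indices n N)"
    using multi_indices_transpose_iff[OF assms]
    by (intro bij_betw_byWitness[where f' = "\<lambda>a. a \<circ> transpose k l"]) (auto simp: comp_assoc)
  have "pairing n N (P_op k l x) y = pairing n N x (P_op k l y)" for x y
    unfolding pairing_def P_op_def
    using sum.reindex_bij_betw[OF bij, of "\<lambda>a. x (a \<circ> transpose k l) * y a"]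
    by (simp add: comp_assoc)
  then show ?thesis
    using multi_indices_transpose_iff[OF assms]
    by (simp add: adjoint_pair_def apply_op_simps) (simp add: tensors_def P_op_def)
qed

lemma adjoint_pair_Q_lin:
  assumes "k \<in> {1..n}" "l \<in> {1..n}" "k \<noteq> l"
  shows "adjoint_pair n N (Q_lin n N k l) (Q_lin n N k l)"
proof -
  let ?A = "{a \<in> multi_indices n N. a k = a l} \<times> {1..N}"
  \<comment> \<open>The involution that exchanges the common value of \<open>a\<close> at \<open>k, l\<close> with the summation index.\<close>
  let ?f = "\<lambda>(a, i). (a(k := i, l := i), a k)"
  have bij: "bij_betw ?f ?A ?A"
    using assms multi_indices_range
    by (intro bij_betw_byWitness[where f' = ?f])
      (auto simp: multi_indices_upd fun_eq_iff)
  have expand: "pairing n N (Q_op n N k l x) y = (\<Sum>(a, i)\<in>?A. x (a(k := i, l := i)) * y a)" for x y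
    unfolding pairing_def sum.cartesian_product[symmetric] Q_op_def
    by (simp add: if_distrib[of "\<lambda>c. c * _"] sum.If_cases finite_multi_indices sum_distrib_right
        Int_def cong: if_cong conj_cong)
  have "pairing n N (Q_op n N k l x) y = pairing n N (Q_op n N k l y) x" for x y
  proof -
    let ?g = "\<lambda>(a, i). x (a(k := i, l := i)) * y a"
    have "(\<Sum>z\<in>?A. ?g z) = (\<Sum>z\<in>?A. ?g (?f z))"
      by (rule sum.reindex_bij_betw[OF bij, symmetric])
    also have "\<dots> = (\<Sum>(a, i)\<in>?A. y (a(k := i, l := i)) * x a)"
    proof (intro sum.cong refl)
      fix z assume "z \<in> ?A"
      then obtain a i where z: "z = (a, i)" "a k = a l"
        by auto
      then have "a(k := i, l := i, k := a k, l := a k) = a"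
        by (auto simp: fun_eq_iff)
      then show "?g (?f z) = (case z of (a, i) \<Rightarrow> y (a(k := i, l := i)) * x a)"
        by (simp only: z split_conv mult.commute)
    qed
    finally show ?thesis
      unfolding expand .
  qed
  then show ?thesis
    by (simp add: adjoint_pair_def apply_op_simps) (simp add: tensors_def Q_op_def pairing_def mult.commute)
qed

lemma adjoint_pair_prod_list:
  assumes "\<And>y. y \<in> set ys \<Longrightarrow> adjoint_pair n N (F y) (F y)"
  shows "adjoint_pair n N (\<Prod>y\<leftarrow>ys. F y) (\<Prod>y\<leftarrow>rev ys. F y)"
  using assms
proof (induction ys)
  case (Cons y ys)
  then show ?case
    using adjoint_pair_mult[of n N "F y" "F y" "\<Prod>y\<leftarrow>ys. F y" "\<Prod>y\<leftarrow>rev ys. F y"] by simp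
qed (simp add: adjoint_pair_one)

lemma adjoint_pair_pair_prod:
  assumes "distinct xs"
    and "\<And>k l. k \<in> set xs \<Longrightarrow> l \<in> set xs \<Longrightarrow> k \<noteq> l \<Longrightarrow> adjoint_pair n N (F k l) (F k l)"
  shows "adjoint_pair n N (pair_prod F xs) (rev_pair_prod F xs)"
  using assms
proof (induction xs)
  case (Cons x xs)
  have "adjoint_pair n N (\<Prod>y\<leftarrow>xs. F x y) (\<Prod>y\<leftarrow>rev xs. F x y)"
    using Cons.prems by (intro adjoint_pair_prod_list) auto
  moreover have "adjoint_pair n N (pair_prod F xs) (rev_pair_prod F xs)"
    using Cons by simp
  ultimately show ?case
    by (simp add: adjoint_pair_mult)
qed (simp add: adjoint_pair_one)

section \<open>The fusion products of a skew diagram\<close>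

lemma polynomial_fun_diff_var:
  assumes "k \<in> {1..n}" "l \<in> {1..n}"
  shows "polynomial_fun n (\<lambda>t. (c + t k) - (d + t l))"
proof -
  have "polynomial_fun n (\<lambda>t. (c + t k) + (-1) * (d + t l))"
    using assms by (intro polynomial_fun.intros)
  moreover have "(\<lambda>t. (c + t k) - (d + t l)) = (\<lambda>t. (c + t k) + (-1) * (d + t l))"
    by (simp add: fun_eq_iff)
  ultimately show ?thesis by simp
qed

lemma polynomial_fun_add_var:
  assumes "k \<in> {1..n}" "l \<in> {1..n}"
  shows "polynomial_fun n (\<lambda>t. (c + t k) + (d + t l))"
  using assms by (intro polynomial_fun.intros)

locale skew_tensors = skew_shape lam mu \<omega> n + brauer_relations scale_op P_lin "Q_lin n N" "{1..n}"
  for lam mu :: "nat \<Rightarrow> nat" and \<omega> :: "(nat \<times> nat) set" and n N :: nat +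
  fixes M :: nat
  assumes lam_bound: "conjugate lam 1 + conjugate lam 2 \<le> N + M"
begin

definition boxes :: "nat list" where
  "boxes = [1..<Suc n]"

definition spectral :: "(nat \<Rightarrow> complex) \<Rightarrow> nat \<Rightarrow> complex" where
  "spectral t k = (of_int (content \<omega> k) + (of_nat N + of_nat M) / 2) + t k"

text \<open>The \<open>Q\<close>-factors that remain once those inside a column are dropped.\<close>

definition Z :: "(nat \<Rightarrow> complex) \<Rightarrow> nat \<Rightarrow> nat \<Rightarrow> (nat \<Rightarrow> nat) operator" where
  "Z t k l = (if same_column \<omega> k l then 1 else B (spectral t) k l)"

text \<open>The regular expression for the \<open>P\<close>-product. The antisymmetrizer is taken at \<open>t = 0\<close>, as on the constrained
subspace it is independent of \<open>t\<close>; its value at a constant point is \<open>E\<^sub>\<Omega>\<close>.\<close>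

definition E_lin :: "(nat \<Rightarrow> complex) \<Rightarrow> (nat \<Rightarrow> nat) operator" where
  "E_lin t = antisymmetrizer (spectral (\<lambda>_. 0)) (columns \<omega>) * column_factors (spectral t) (columns \<omega>)"

lemma boxes: "distinct boxes" "set boxes = {1..n}"
  by (auto simp: boxes_def)

lemma concat_columns': "concat (columns \<omega>) = boxes"
  using concat_columns[OF finite_\<omega>] unfolding boxes_def unfolding n .

lemma lex_pairs_less: "(k, l) \<in> set (lex_pairs n) \<longleftrightarrow> k \<in> {1..n} \<and> l \<in> {1..n} \<and> k < l"
  by (auto simp: lex_pairs_def simp del: upt_Suc intro!: bexI[of _ k])

lemma spectral_diff: "spectral t k - spectral t l = P_denom \<omega> t k l"
  by (simp add: spectral_def P_denom_def)

lemma spectral_sum: "spectral t k + spectral t l = Q_denom N M \<omega> t k l"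
  by (simp add: spectral_def Q_denom_def)

lemma P_prod_eq: "P_prod \<omega> t = apply_op (pair_prod (R (spectral t)) boxes)"
  unfolding P_prod_def boxes_def n[symmetric] ordered_prod_lex_pairs(1)[symmetric] R_def apply_op_one_minus
    spectral_diff P_lin.rep_eq ..

lemma Q_prod_eq: "Q_prod N M \<omega> t = apply_op (pair_prod (B (spectral t)) boxes)"
  unfolding Q_prod_def boxes_def n[symmetric] ordered_prod_lex_pairs(1)[symmetric] B_def apply_op_one_minus
    spectral_sum Q_lin.rep_eq ..

lemma inj_on_spectral:
  assumes "t \<in> P_domain \<omega>"
  shows "inj_on (spectral t) {1..n}"
proof (rule inj_onI, rule ccontr)
  fix k l assume kl: "k \<in> {1..n}" "l \<in> {1..n}" "spectral t k = spectral t l" "k \<noteq> l"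
  have *: "spectral t k - spectral t l \<noteq> 0" if "k \<in> {1..n}" "l \<in> {1..n}" "k < l" for k l
    using assms that unfolding spectral_diff P_domain_def n[symmetric]
    by (auto simp: lex_pairs_less)
  show False
    using *[of k l] *[of l k] kl by (cases k l rule: linorder_cases) auto
qed

lemma spectral_sum_nonzero:
  assumes "t \<in> Q_domain N M \<omega>" "k \<in> {1..n}" "l \<in> {1..n}" "k \<noteq> l"
  shows "spectral t k + spectral t l \<noteq> 0"
proof -
  have *: "spectral t k + spectral t l \<noteq> 0" if "k \<in> {1..n}" "l \<in> {1..n}" "k < l" for k l
    using assms(1) that unfolding spectral_sum Q_domain_def n[symmetric]
    by (auto simp: lex_pairs_less)
  show ?thesis
    using *[of k l] *[of l k] assms(2-4)
    by (cases k l rule: linorder_cases) (auto simp: add.commute)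
qed

lemma constrained_D:
  assumes "t \<in> constrained \<omega>" "k \<in> {1..n}" "l \<in> {1..n}" "col \<omega> k = col \<omega> l"
  shows "t k = t l"
  using assms n unfolding constrained_def same_column_eq by blast

lemma column_columns:
  assumes "t \<in> constrained \<omega>" "C \<in> set (columns \<omega>)"
  shows "column (spectral t) C"
proof -
  have C: "k \<in> {1..n}" "col \<omega> k = col \<omega> l" if "k \<in> set C" "l \<in> set C" for k l
    using set_columns[OF assms(2) that(1)] set_columns[OF assms(2) that(2)] that n by auto
  have diff: "spectral t k - spectral t l = of_int (int (row \<omega> l) - int (row \<omega> k))"
    if "k \<in> set C" "l \<in> set C" for k l
  proof -
    have col: "col \<omega> k = col \<omega> l"
      by (rule C(2)[OF that])
    have "t k = t l"
      by (rule constrained_D[OF assms(1) C(1)[OF that] C(1)[OF that(2,1)] col])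
    with col show ?thesis
      by (simp add: spectral_def content_eq)
  qed
  have "k = l" if "k \<in> set C" "l \<in> set C" "spectral t k = spectral t l" for k l
  proof -
    have "row \<omega> k = row \<omega> l"
      using diff[OF that(1,2)] that(3) by simp
    then show ?thesis
      using row_col_less[OF finite_\<omega>, of k l] row_col_less[OF finite_\<omega>, of l k]
        C[OF that(1,2)] C(1)[OF that(2,1)] unfolding n[symmetric]
      by (cases k l rule: linorder_cases) auto
  qed
  then have "inj_on (spectral t) (set C)"
    by (rule inj_onI)
  moreover have "successively (\<lambda>k l. spectral t k - spectral t l = 1) C"
    using column_rows_consecutive[OF assms(2)]
    by (rule successively_mono) (auto simp: diff)
  moreover have "distinct C" "set C \<subseteq> {1..n}"
    using assms(2) C(1) by (auto simp: columns_def simp del: upt_Suc)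
  ultimately show ?thesis
    unfolding column_def by blast
qed

lemma antisymmetrizer_spectral:
  assumes "t \<in> constrained \<omega>"
  shows "antisymmetrizer (spectral t) (columns \<omega>) = antisymmetrizer (spectral (\<lambda>_. 0)) (columns \<omega>)"
  unfolding antisymmetrizer_def
proof (intro arg_cong[of _ _ prod_list] map_cong refl pair_prod_cong)
  fix C k l assume C: "C \<in> set (columns \<omega>)" "k \<in> set C" "l \<in> set C"
  then have "t k = t l"
    using set_columns[OF C(1,2)] n by (intro constrained_D[OF assms]) auto
  then show "R (spectral t) k l = R (spectral (\<lambda>_. 0)) k l"
    by (simp add: R_def spectral_def)
qed

lemma P_prod_eq_E_lin:
  assumes "t \<in> P_domain \<omega>"
  shows "pair_prod (R (spectral t)) boxes = E_lin t"
proof -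
  have t: "t \<in> constrained \<omega>"
    using assms by (simp add: P_domain_def)
  have "pair_prod (R (spectral t)) (concat (columns \<omega>)) =
      antisymmetrizer (spectral t) (columns \<omega>) * column_factors (spectral t) (columns \<omega>)"
    using inj_on_spectral[OF assms] column_columns[OF t]
    by (intro fusion_factorization) (auto simp only: concat_columns' boxes)
  then show ?thesis
    unfolding E_lin_def antisymmetrizer_spectral[OF t] concat_columns' .
qed

lemma Q_prod_E_lin:
  assumes "t \<in> P_domain \<omega> \<inter> Q_domain N M \<omega>"
  shows "pair_prod (B (spectral t)) boxes * E_lin t = pair_prod (Z t) boxes * E_lin t"
proof -
  have t: "t \<in> constrained \<omega>"
    using assms by (simp add: P_domain_def)
  have "pair_prod (B (spectral t)) (concat (columns \<omega>)) * antisymmetrizer (spectral t) (columns \<omega>) =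
      pair_prod (\<lambda>k l. if same_column \<omega> k l then 1 else B (spectral t) k l) (concat (columns \<omega>)) *
      antisymmetrizer (spectral t) (columns \<omega>)"
  proof (rule reduced_B_product)
    fix C k l assume C: "C \<in> set (columns \<omega>)" "k \<in> set C" "l \<in> set (concat (columns \<omega>))"
    then have "l \<in> {1..card \<omega>}"
      unfolding concat_columns' boxes unfolding n by blast
    then show "same_column \<omega> k l \<longleftrightarrow> l \<in> set C"
      unfolding same_column_eq set_columns(1)[OF C(1,2)] by auto
  qed (use column_columns[OF t] spectral_sum_nonzero assms in \<open>auto simp only: concat_columns' boxes Int_iff\<close>)
  then show ?thesis
    unfolding E_lin_def antisymmetrizer_spectral[OF t] concat_columns' Z_def[abs_def]
    by (simp only: mult.assoc[symmetric])
qed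

lemma adjoint_pair_R: "k \<in> {1..n} \<Longrightarrow> l \<in> {1..n} \<Longrightarrow> adjoint_pair n N (R y k l) (R y k l)"
  unfolding R_def by (intro adjoint_pair_one_minus_scale adjoint_pair_P_lin)

lemma adjoint_pair_B: "k \<in> {1..n} \<Longrightarrow> l \<in> {1..n} \<Longrightarrow> k \<noteq> l \<Longrightarrow> adjoint_pair n N (B y k l) (B y k l)"
  unfolding B_def by (intro adjoint_pair_one_minus_scale adjoint_pair_Q_lin)

lemma adjoint_pair_Z: "adjoint_pair n N (pair_prod (Z t) boxes) (rev_pair_prod (Z t) boxes)"
proof (rule adjoint_pair_pair_prod)
  show "adjoint_pair n N (Z t k l) (Z t k l)" if "k \<in> set boxes" "l \<in> set boxes" "k \<noteq> l" for k l
    using that unfolding boxes(2) by (simp add: Z_def adjoint_pair_one adjoint_pair_B)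
qed (rule boxes)

lemma adjoint_pair_E_lin:
  assumes "t \<in> P_domain \<omega>"
  shows "adjoint_pair n N (E_lin t) (E_lin t)"
proof -
  have inj: "inj_on (spectral t) (set boxes)"
    using inj_on_spectral assms boxes by auto
  have E: "pair_prod (R (spectral t)) boxes = E_lin t"
    using P_prod_eq_E_lin assms by simp
  have "rev_pair_prod (R (spectral t)) boxes = E_lin t"
    using fusion_eq_rev_fusion[OF boxes(1) _ inj] E boxes by simp
  moreover have "adjoint_pair n N (pair_prod (R (spectral t)) boxes) (rev_pair_prod (R (spectral t)) boxes)"
    using adjoint_pair_R unfolding boxes(2)[symmetric] by (intro adjoint_pair_pair_prod boxes(1))
  ultimately show ?thesis
    unfolding E by simp
qed

text \<open>The operator \<open>Q P = Z P\<close> has the two adjoints \<open>P Q\<^sup>r\<close> and \<open>P Z\<^sup>r\<close>, where \<open>r\<close> denotes the reversed product. They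
agree on tensors, and the first of them equals \<open>Q P\<close> by the exchange of the full products.\<close>

lemma Z_E_lin_exchange:
  assumes t: "t \<in> P_domain \<omega> \<inter> Q_domain N M \<omega>" and x: "x \<in> tensors n N"
  shows "apply_op (pair_prod (Z t) boxes * E_lin t) x = apply_op (E_lin t * rev_pair_prod (Z t) boxes) x"
proof -
  let ?QF = "pair_prod (B (spectral t)) boxes" and ?QR = "rev_pair_prod (B (spectral t)) boxes"
  let ?ZF = "pair_prod (Z t) boxes" and ?ZR = "rev_pair_prod (Z t) boxes"
  have t': "t \<in> P_domain \<omega>"
    using t by simp
  have "?QF * pair_prod (R (spectral t)) boxes = pair_prod (R (spectral t)) boxes * ?QR"
    using inj_on_spectral[OF t'] spectral_sum_nonzero t
    by (intro B_fusion_exchange) (auto simp only: boxes Int_iff)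
  then have exchange: "?QF * E_lin t = E_lin t * ?QR"
    unfolding P_prod_eq_E_lin[OF t'] .
  have Q_Z: "?QF * E_lin t = ?ZF * E_lin t"
    by (rule Q_prod_E_lin[OF t])
  have "adjoint_pair n N ?QF ?QR"
    using adjoint_pair_B unfolding boxes(2)[symmetric] by (intro adjoint_pair_pair_prod boxes(1))
  then have 1: "adjoint_pair n N (?QF * E_lin t) (E_lin t * ?QR)"
    by (intro adjoint_pair_mult adjoint_pair_E_lin[OF t'])
  have 2: "adjoint_pair n N (?QF * E_lin t) (E_lin t * ?ZR)"
    unfolding Q_Z by (intro adjoint_pair_mult adjoint_pair_E_lin[OF t'] adjoint_pair_Z)
  have "apply_op (E_lin t * ?QR) x = apply_op (E_lin t * ?ZR) x"
  proof (rule pairing_nondegenerate)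
    fix z assume "z \<in> tensors n N"
    then show "pairing n N z (apply_op (E_lin t * ?QR) x) = pairing n N z (apply_op (E_lin t * ?ZR) x)"
      using 1 2 x unfolding adjoint_pair_def by metis
  qed (use 1 2 x in \<open>auto simp: adjoint_pair_def\<close>)
  then show ?thesis
    unfolding Q_Z[symmetric] exchange .
qed

lemma regular_family_E_lin:
  assumes D: "D \<subseteq> P_domain \<omega>"
  shows "regular_family n D (\<lambda>_. z) E_lin"
proof -
  let ?reg = "regular_family n D (\<lambda>_. z)"
  have S: "?reg (\<lambda>t. column_factor (spectral t) k C)"
    if C: "C \<in> set (columns \<omega>)" and k: "k \<in> {1..n}" "\<forall>l\<in>set C. col \<omega> k < col \<omega> l" for k C
  proof (cases C)
    case Nil
    then show ?thesis
      by (simp add: column_factor_def regular_family_one)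
  next
    case (Cons b C')
    then have b: "hd C = b" "b \<in> set C"
      by auto
    have b': "b \<in> {1..n}" "b \<noteq> k"
      using set_columns(2)[OF C b(2)] k(2) b(2) n by auto
    have ne: "spectral t k - spectral t b \<noteq> 0" if "t \<in> insert (\<lambda>_. z) D" for t
    proof (cases "t \<in> P_domain \<omega>")
      case True
      then show ?thesis
        using inj_onD[OF inj_on_spectral[OF True], of k b] b' k(1) by auto
    next
      case False
      have "content \<omega> k \<noteq> content \<omega> b"
        using content_ne_top_of_later_column[OF C b(2) k(1)] k(2) b by simp
      then show ?thesis
        using False that D by (auto simp: spectral_def)
    qed
    have "regular_at n D (\<lambda>_. z) (\<lambda>t. inverse (spectral t k - spectral t b))"
    proof (rule regular_at_inverse)
      show "polynomial_fun n (\<lambda>t. spectral t k - spectral t b)"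
        unfolding spectral_def by (intro polynomial_fun_diff_var k(1) b'(1))
    qed (rule ne)
    then show ?thesis
      unfolding column_factor_def b(1)
      by (intro regular_family_diff regular_family_one regular_family_scale regular_family_sum_list
          regular_family_P_lin)
  qed
  have "?reg (\<lambda>t. column_factors (spectral t) cs)"
    if "set cs \<subseteq> set (columns \<omega>)" "sorted_wrt (\<lambda>C C'. \<forall>k\<in>set C. \<forall>l\<in>set C'. col \<omega> k < col \<omega> l) cs" for cs
    using that
  proof (induction cs)
    case (Cons C cs)
    have "?reg (\<lambda>t. \<Prod>k\<leftarrow>C. \<Prod>C'\<leftarrow>cs. column_factor (spectral t) k C')"
    proof (intro regular_family_prod_list S)
      show "k \<in> {1..n}" if "k \<in> set C" for k
        using set_columns(2)[of C \<omega> k] Cons.prems(1) that n by auto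
    qed (use Cons.prems in auto)
    moreover have "?reg (\<lambda>t. column_factors (spectral t) cs)"
      using Cons by simp
    ultimately show ?case
      by (simp add: regular_family_mult)
  qed (simp add: regular_family_one)
  moreover have "sorted_wrt (\<lambda>C C'. \<forall>k\<in>set C. \<forall>l\<in>set C'. col \<omega> k < col \<omega> l) (columns \<omega>)"
    unfolding columns_def sorted_wrt_map
    by (rule sorted_wrt_mono_rel[OF _ sorted_wrt_upt]) (simp del: upt_Suc)
  ultimately have "?reg (\<lambda>t. column_factors (spectral t) (columns \<omega>))"
    by blast
  moreover have "?reg (\<lambda>t. antisymmetrizer (spectral (\<lambda>_. 0)) (columns \<omega>))"
    unfolding antisymmetrizer_def
  proof (rule regular_family_prod_list)
    fix C assume C: "C \<in> set (columns \<omega>)"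
    then have "distinct C"
      by (auto simp: columns_def simp del: upt_Suc)
    then show "?reg (\<lambda>t. pair_prod (R (spectral (\<lambda>_. 0))) C)"
      unfolding R_def
      by (intro regular_family_pair_prod regular_family_diff regular_family_one regular_family_scale
          regular_at_const regular_family_P_lin)
  qed
  ultimately show ?thesis
    unfolding E_lin_def[abs_def] by (intro regular_family_mult)
qed

lemma regular_family_Z:
  assumes D: "D \<subseteq> Q_domain N M \<omega>"
  shows "regular_family n D (\<lambda>_. -1/2) (\<lambda>t. pair_prod (Z t) boxes)"
    and "regular_family n D (\<lambda>_. -1/2) (\<lambda>t. rev_pair_prod (Z t) boxes)"
proof -
  let ?reg = "regular_family n D (\<lambda>_. -1/2)"
  have Z: "?reg (\<lambda>t. Z t k l)" if kl: "k \<in> {1..n}" "l \<in> {1..n}" "k \<noteq> l" for k l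
  proof (cases "same_column \<omega> k l")
    case True
    then show ?thesis
      by (simp add: Z_def regular_family_one)
  next
    case False
    have "0 < content \<omega> k + content \<omega> l + int (N + M) - 1"
      using content_sum_bound[OF lam_bound kl(1,2)] False by (simp add: same_column_eq)
    then have "of_int (content \<omega> k + content \<omega> l + int (N + M) - 1) \<noteq> (0 :: complex)"
      unfolding of_int_eq_0_iff by simp
    then have at: "spectral (\<lambda>_. -1/2) k + spectral (\<lambda>_. -1/2) l \<noteq> 0"
      by (simp add: spectral_def algebra_simps)
    have "regular_at n D (\<lambda>_. -1/2) (\<lambda>t. inverse (spectral t k + spectral t l))"
    proof (rule regular_at_inverse)
      show "polynomial_fun n (\<lambda>t. spectral t k + spectral t l)"
        unfolding spectral_def by (intro polynomial_fun_add_var kl(1,2))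
      show "spectral t k + spectral t l \<noteq> 0" if "t \<in> insert (\<lambda>_. -1/2) D" for t
        using that at spectral_sum_nonzero[of t k l] kl D by blast
    qed
    with False show ?thesis
      by (simp add: Z_def B_def regular_family_diff regular_family_one regular_family_scale
          regular_family_Q_lin)
  qed
  show "?reg (\<lambda>t. pair_prod (Z t) boxes)" "?reg (\<lambda>t. rev_pair_prod (Z t) boxes)"
    using Z unfolding boxes(2)[symmetric] by (auto intro!: regular_family_pair_prod boxes(1))
qed

text \<open>Moving \<open>t\<close> away from a constant point in proportion to the column index keeps it on the constrained subspace.
Along this line every denominator is an affine function that is not identically zero: contents differ
within a column, and the variables differ between columns.\<close>

lemma eventually_in_domain:
  "\<forall>\<^sub>F s in at (0::complex). (\<lambda>k. z + s * of_nat (col \<omega> k)) \<in> P_domain \<omega> \<inter> Q_domain N M \<omega>"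
proof -
  let ?t = "\<lambda>s k. z + s * of_nat (col \<omega> k)"
  have constrained: "?t s \<in> constrained \<omega>" for s
    by (simp add: constrained_def same_column_eq)
  have "\<forall>\<^sub>F s in at 0. P_denom \<omega> (?t s) k l \<noteq> 0 \<and> Q_denom N M \<omega> (?t s) k l \<noteq> 0"
    if kl: "(k, l) \<in> set (lex_pairs n)" for k l
  proof -
    have kl: "k \<in> {1..n}" "l \<in> {1..n}" "k < l"
      using kl by (auto simp: lex_pairs_less)
    have P: "P_denom \<omega> (?t s) k l = of_int (content \<omega> k - content \<omega> l) +
        s * of_int (int (col \<omega> k) - int (col \<omega> l))" for s
      by (simp add: P_denom_def algebra_simps)
    have Q: "Q_denom N M \<omega> (?t s) k l = (of_int (content \<omega> k + content \<omega> l) + 2 * z + of_nat N + of_nat M) +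
        s * of_nat (col \<omega> k + col \<omega> l)" for s
      by (simp add: Q_denom_def algebra_simps)
    have "content \<omega> k \<noteq> content \<omega> l \<or> col \<omega> k \<noteq> col \<omega> l"
      using row_col_less[OF finite_\<omega>, of k l] kl n by (auto simp: content_eq)
    then have "of_int (content \<omega> k - content \<omega> l) \<noteq> (0::complex) \<or>
        of_int (int (col \<omega> k) - int (col \<omega> l)) \<noteq> (0::complex)"
      unfolding of_int_eq_0_iff by simp
    moreover have "(of_nat (col \<omega> k + col \<omega> l) :: complex) \<noteq> 0"
      using box_in_shape(2)[OF kl(1)] unfolding of_nat_eq_0_iff by simp
    ultimately show ?thesis
      unfolding P Q by (intro eventually_conj eventually_affine_nonzero) auto
  qed
  then have "\<forall>\<^sub>F s in at 0. \<forall>p\<in>set (lex_pairs n). case p of (k, l) \<Rightarrow>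
      P_denom \<omega> (?t s) k l \<noteq> 0 \<and> Q_denom N M \<omega> (?t s) k l \<noteq> 0"
    by (intro eventually_ball_finite) auto
  then show ?thesis
    by (rule eventually_mono) (use constrained n in \<open>auto simp: P_domain_def Q_domain_def\<close>)
qed

lemma E_lin_const: "E_lin (\<lambda>_. z) = E_lin (\<lambda>_. 0)"
proof -
  have "column_factors (spectral (\<lambda>_. z)) cs = column_factors (spectral (\<lambda>_. 0)) cs" for cs
    by (induction cs) (simp_all add: column_factor_def spectral_def)
  then show ?thesis
    by (simp add: E_lin_def)
qed

lemma value_unique:
  assumes "has_regular_value n D f (\<lambda>_. z) v" "has_regular_value n D f (\<lambda>_. z) v'"
    and "P_domain \<omega> \<inter> Q_domain N M \<omega> \<subseteq> D"
  shows "v = v'"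
  using assms(1,2)
proof (rule has_regular_value_unique)
  show "\<forall>\<^sub>F s in at (0::complex). (\<lambda>k. z + s * of_nat (col \<omega> k)) \<in> D"
    using eventually_in_domain by (rule eventually_mono) (use assms(3) in blast)
qed

lemma E_lin_regular_value:
  "has_regular_value n (P_domain \<omega>) (\<lambda>t. P_prod \<omega> t x a) (\<lambda>_. z) (apply_op (E_lin (\<lambda>_. z)) x a)"
  by (rule has_regular_value_cong[OF regular_familyD[OF regular_family_E_lin[OF order_refl]]])
    (simp_all add: P_prod_eq P_prod_eq_E_lin)

text \<open>The coordinates outside the multi-indices vanish on the domain, where the operator is a product
of operators \<open>1 - c P\<^sub>k\<^sub>l\<close>, so they vanish at the point.\<close>

lemma E_lin_tensors:
  assumes "x \<in> tensors n N"
  shows "apply_op (E_lin (\<lambda>_. z)) x \<in> tensors n N"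
  unfolding tensors_def
proof (intro CollectI allI impI)
  fix a assume a: "a \<notin> multi_indices n N"
  have "P_prod \<omega> t x a = 0" if "t \<in> P_domain \<omega>" for t
    using adjoint_pair_E_lin[OF that] assms a P_prod_eq P_prod_eq_E_lin[OF that]
    by (auto simp: adjoint_pair_def tensors_def)
  then have "has_regular_value n (P_domain \<omega>) (\<lambda>t. P_prod \<omega> t x a) (\<lambda>_. z) 0"
    by (intro has_regular_value_cong[OF regular_at_const[of n "P_domain \<omega>" _ 0]]) auto
  from value_unique[OF E_lin_regular_value this]
  show "apply_op (E_lin (\<lambda>_. z)) x a = 0"
    by blast
qed

text \<open>The expression \<open>E_lin\<close> has the properties that describe \<open>E_op\<close>, and these determine the operator by uniqueness of
regular values.\<close>

lemma E_op_eq: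
  assumes "x \<in> tensors n N"
  shows "E_op N \<omega> x = apply_op (E_lin (\<lambda>_. z)) x"
proof -
  let ?A = "restrict (apply_op (E_lin (\<lambda>_. 0))) (tensors n N)"
  let ?char = "\<lambda>A. A \<in> tensors n N \<rightarrow>\<^sub>E tensors n N \<and>
    (\<forall>z. has_operator_value n N (P_domain \<omega>) (P_prod \<omega>) (\<lambda>_. z) A)"
  have val: "has_regular_value n (P_domain \<omega>) (\<lambda>t. P_prod \<omega> t x a) (\<lambda>_. z) (apply_op (E_lin (\<lambda>_. 0)) x a)"
    for x a z
    using E_lin_regular_value[of x a z] by (simp only: E_lin_const[of z])
  have A: "?char ?A"
    using val E_lin_tensors[of _ 0] by (simp add: has_operator_value_def)
  have "A = ?A" if "?char A" for A
  proof
    fix y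
    show "A y = ?A y"
    proof (cases "y \<in> tensors n N")
      case y: True
      have "A y a = ?A y a" for a
      proof (cases "a \<in> multi_indices n N")
        case True
        have "has_regular_value n (P_domain \<omega>) (\<lambda>t. P_prod \<omega> t y a) (\<lambda>_. 0) (A y a)"
          "has_regular_value n (P_domain \<omega>) (\<lambda>t. P_prod \<omega> t y a) (\<lambda>_. 0) (?A y a)"
          using that A y True unfolding has_operator_value_def by blast+
        then show ?thesis
          by (rule value_unique) blast
      next
        case False
        have "A y \<in> tensors n N" "?A y \<in> tensors n N"
          using that A y by blast+
        then show ?thesis
          using False by (simp add: tensors_def)
      qed
      then show ?thesis ..
    next
      case False
      have "A y = undefined"
        by (rule PiE_arb[of A "tensors n N" "\<lambda>_. tensors n N"]) (use that False in blast)+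
      then show ?thesis
        using False by simp
    qed
  qed
  with A have "E_op N \<omega> = ?A"
    unfolding E_op_def n[symmetric] by (rule the_equality)
  then show ?thesis
    using assms by (simp add: E_lin_const[of z])
qed

lemma Q_factor_products:
  "ordered_prod (Q_factor N M \<omega>) (different_column_pairs \<omega>) = apply_op (pair_prod (Z (\<lambda>_. -1/2)) boxes)"
  "ordered_prod (Q_factor N M \<omega>) (rev (different_column_pairs \<omega>)) =
     apply_op (rev_pair_prod (Z (\<lambda>_. -1/2)) boxes)"
proof -
  have factor: "(if \<not> same_column \<omega> k l then Q_factor N M \<omega> k l else id) = apply_op (Z (\<lambda>_. -1/2) k l)" for k l
  proof -
    have "of_int (content \<omega> k + content \<omega> l + int N + int M - 1) =
        spectral (\<lambda>_. -1/2) k + spectral (\<lambda>_. -1/2) l"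
      by (simp add: spectral_def field_simps)
    then show ?thesis
      by (simp add: Z_def Q_factor_def B_def apply_op_one_minus Q_lin.rep_eq one_operator.rep_eq id_def
          flip: n)
  qed
  show "ordered_prod (Q_factor N M \<omega>) (different_column_pairs \<omega>) = apply_op (pair_prod (Z (\<lambda>_. -1/2)) boxes)"
    "ordered_prod (Q_factor N M \<omega>) (rev (different_column_pairs \<omega>)) =
       apply_op (rev_pair_prod (Z (\<lambda>_. -1/2)) boxes)"
    unfolding different_column_pairs_def boxes_def n[symmetric] rev_filter ordered_prod_filter factor
      ordered_prod_lex_pairs by (rule refl)+
qed

lemma Z_tensors:
  assumes "x \<in> tensors n N"
  shows "apply_op (pair_prod (Z t) boxes) x \<in> tensors n N" "apply_op (rev_pair_prod (Z t) boxes) x \<in> tensors n N"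
  using adjoint_pair_Z[of t] assms by (auto simp: adjoint_pair_def)

lemma value_at_minus_half:
  "has_operator_value n N (P_domain \<omega> \<inter> Q_domain N M \<omega>)
     (\<lambda>t. Q_prod N M \<omega> t \<circ> P_prod \<omega> t) (\<lambda>_. - 1 / 2)
     (ordered_prod (Q_factor N M \<omega>) (different_column_pairs \<omega>) \<circ> E_op N \<omega>)"
  unfolding has_operator_value_def
proof (intro ballI conjI)
  let ?D = "P_domain \<omega> \<inter> Q_domain N M \<omega>" and ?t0 = "\<lambda>_::nat. -1/2 :: complex"
  fix x a assume x: "x \<in> tensors n N"
  let ?v = "apply_op (pair_prod (Z ?t0) boxes * E_lin ?t0) x"
  have v: "(ordered_prod (Q_factor N M \<omega>) (different_column_pairs \<omega>) \<circ> E_op N \<omega>) x = ?v"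
    by (simp add: Q_factor_products E_op_eq[OF x, of "-1/2"] times_operator.rep_eq)
  show "(ordered_prod (Q_factor N M \<omega>) (different_column_pairs \<omega>) \<circ> E_op N \<omega>) x \<in> tensors n N"
    unfolding v times_operator.rep_eq by (intro Z_tensors E_lin_tensors x)
  have "regular_family n ?D ?t0 (\<lambda>t. pair_prod (Z t) boxes * E_lin t)"
    by (intro regular_family_mult regular_family_Z(1) regular_family_E_lin) auto
  from regular_familyD[OF this]
  have "has_regular_value n ?D (\<lambda>t. (Q_prod N M \<omega> t \<circ> P_prod \<omega> t) x a) ?t0 (?v a)"
  proof (rule has_regular_value_cong)
    fix t assume t: "t \<in> ?D"
    then show "apply_op (pair_prod (Z t) boxes * E_lin t) x a = (Q_prod N M \<omega> t \<circ> P_prod \<omega> t) x a"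
      unfolding Q_prod_E_lin[OF t, symmetric]
      by (simp add: P_prod_eq Q_prod_eq P_prod_eq_E_lin times_operator.rep_eq)
  qed simp
  then show "has_regular_value n ?D (\<lambda>t. (Q_prod N M \<omega> t \<circ> P_prod \<omega> t) x a) ?t0
      ((ordered_prod (Q_factor N M \<omega>) (different_column_pairs \<omega>) \<circ> E_op N \<omega>) x a)"
    unfolding v .
qed

text \<open>Both sides are regular values at the same point of two families that agree on the domain.\<close>

lemma value_exchange:
  assumes x: "x \<in> tensors n N"
  shows "(ordered_prod (Q_factor N M \<omega>) (different_column_pairs \<omega>) \<circ> E_op N \<omega>) x =
    (E_op N \<omega> \<circ> ordered_prod (Q_factor N M \<omega>) (rev (different_column_pairs \<omega>))) x"
proof
  fix a
  let ?D = "P_domain \<omega> \<inter> Q_domain N M \<omega>" and ?t0 = "\<lambda>_::nat. -1/2 :: complex"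
  let ?F = "\<lambda>t. pair_prod (Z t) boxes * E_lin t" and ?G = "\<lambda>t. E_lin t * rev_pair_prod (Z t) boxes"
  have reg: "regular_family n ?D ?t0 ?F" "regular_family n ?D ?t0 ?G"
    by (rule regular_family_mult, (rule regular_family_Z regular_family_E_lin, simp)+)+
  have "has_regular_value n ?D (\<lambda>t. apply_op (?F t) x a) ?t0 (apply_op (?F ?t0) x a)"
    by (rule has_regular_value_cong[OF regular_familyD[OF reg(1)]]) auto
  moreover have "has_regular_value n ?D (\<lambda>t. apply_op (?F t) x a) ?t0 (apply_op (?G ?t0) x a)"
    by (rule has_regular_value_cong[OF regular_familyD[OF reg(2)]]) (simp_all add: Z_E_lin_exchange x)
  ultimately have "apply_op (?F ?t0) x a = apply_op (?G ?t0) x a"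
    by (rule value_unique) simp
  then show "(ordered_prod (Q_factor N M \<omega>) (different_column_pairs \<omega>) \<circ> E_op N \<omega>) x a =
      (E_op N \<omega> \<circ> ordered_prod (Q_factor N M \<omega>) (rev (different_column_pairs \<omega>))) x a"
    by (simp add: Q_factor_products E_op_eq[OF x, of "-1/2"] E_op_eq[OF Z_tensors(2)[OF x], of _ "-1/2"]
        times_operator.rep_eq)
qed

end

theorem proposition3:
  fixes N M :: nat and lam mu :: "nat \<Rightarrow> nat"
  assumes "N \<ge> 1"
    and "is_partition lam" and "is_partition mu"
    and "\<forall>k\<ge>1. lam k \<ge> mu k"
    and "conjugate lam 1 + conjugate lam 2 \<le> N + M"
    and "conjugate mu 1 + conjugate mu 2 \<le> M"
    and "\<omega> = skew_diagram lam mu" and "n = card \<omega>"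
  shows "has_operator_value n N (P_domain \<omega> \<inter> Q_domain N M \<omega>)
           (\<lambda>t. Q_prod N M \<omega> t \<circ> P_prod \<omega> t) (\<lambda>_. - 1 / 2)
           (ordered_prod (Q_factor N M \<omega>) (different_column_pairs \<omega>) \<circ> E_op N \<omega>) \<and>
         (\<forall>x\<in>tensors n N.
           (ordered_prod (Q_factor N M \<omega>) (different_column_pairs \<omega>) \<circ> E_op N \<omega>) x =
           (E_op N \<omega> \<circ> ordered_prod (Q_factor N M \<omega>) (rev (different_column_pairs \<omega>))) x)"
proof -
  interpret brauer_relations scale_op P_lin "Q_lin n N" "{1..n}"
    by (rule brauer_relations_tensors)
  interpret skew_tensors lam mu \<omega> n N M
    by unfold_locales fact+
  show ?thesis
    using value_at_minus_half value_exchange by blast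
qed

end
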